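(* Let $\mathbf X,\mathbf Y,\mathbf Z,\mathbf S$ be pairwise disjoint node sets in a causal DAG $\mathcal D$ with $\mathbf Z\cap\mathrm{De}(\mathbf X,\mathcal D)=\emptyset$. If $\mathbf S$ satisfies the conditional adjustment criterion relative to $(\mathbf X,\mathbf Y,\mathbf Z)$ in $\mathcal D$, then $\mathbf S$ is a conditional adjustment set relative to $(\mathbf X,\mathbf Y,\mathbf Z)$ in $\mathcal D$.
   Context: DAG setting. In a DAG $\mathcal D=(\mathbf V,\mathbf E)$, a path is a sequence of distinct nodes with successive nodes adjacent; a path from $\mathbf X$ to $\mathbf Y$ runs from some $X\in\mathbf X$ to some $Y\in\mathbf Y$ and is proper if only its first node is in $\mathbf X$. A path $X\to\cdots\to Y$ is causal; otherwise it is non-causal. A non-endpoint $V_j$ on a path is a collider if $V_{j-1}\to V_j\leftarrow V_{j+1}$, else a non-collider. Descendants $\mathrm{De}$ and ancestors $\mathrm{An}$ include the node itself. A path is d-connecting given $\mathbf Z$ if no non-collider on it is in $\mathbf Z$ and every collider on it has a descendant in $\mathbf Z$; otherwise blocked. Mediators of $\mathbf X,\mathbf Y$: all non-first nodes on proper causal paths from $\mathbf X$ to $\mathbf Y$; $\mathrm{Forb}(\mathbf X,\mathbf Y,\mathcal D)=\mathrm{De}(\text{mediators},\mathcal D)$. Causal semantics. Densities are positive. A family $\{f(\mathbf v\mid do(\mathbf x')):\mathbf X'\subseteq\mathbf V\}$ is compatible with causal $\mathcal D$ if each member equals $\prod_{V_i\in\mathbf V\setminus\mathbf X'}f(v_i\mid\mathrm{pa}(v_i,\mathcal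 D))\mathbb 1(\mathbf X'=\mathbf x')$; an interventional density is consistent with $\mathcal D$ if it belongs to such a family. Conditional adjustment set: $\mathbf S$ is one relative to $(\mathbf X,\mathbf Y,\mathbf Z)$ in $\mathcal D$ if for every density $f$ consistent with $\mathcal D$, $f(\mathbf y\mid do(\mathbf x),\mathbf z)=f(\mathbf y\mid\mathbf x,\mathbf z)$ when $\mathbf S=\emptyset$ and $=\int f(\mathbf y\mid\mathbf x,\mathbf z,\mathbf s)f(\mathbf s\mid\mathbf z)d\mathbf s$ otherwise. Conditional adjustment criterion (in a DAG, with $\mathbf Z\cap\mathrm{De}(\mathbf X,\mathcal D)=\emptyset$): (a) $\mathbf S\cap\mathrm{Forb}(\mathbf X,\mathbf Y,\mathcal D)=\emptyset$ and (b) $\mathbf S\cup\mathbf Z$ blocks all proper non-causal paths from $\mathbf X$ to $\mathbf Y$ in $\mathcal D$. *)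

theory Defs
  imports "HOL-Analysis.Analysis"
begin

definition is_dag :: "'v set \<Rightarrow> ('v \<times> 'v) set \<Rightarrow> bool" where
  "is_dag V E \<longleftrightarrow> finite V \<and> E \<subseteq> V \<times> V \<and> acyclic E"

definition adjacent :: "('v \<times> 'v) set \<Rightarrow> 'v \<Rightarrow> 'v \<Rightarrow> bool" where
  "adjacent E a b \<longleftrightarrow> (a, b) \<in> E \<or> (b, a) \<in> E"

definition is_path :: "('v \<times> 'v) set \<Rightarrow> 'v list \<Rightarrow> bool" where
  "is_path E p \<longleftrightarrow> p \<noteq> [] \<and> distinct p \<and>
     (\<forall>i. Suc i < length p \<longrightarrow> adjacent E (p ! i) (p ! Suc i))"

definition path_from_to :: "('v \<times> 'v) set \<Rightarrow> 'v set \<Rightarrow> 'v set \<Rightarrow> 'v list \<Rightarrow> bool" where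
  "path_from_to E A B p \<longleftrightarrow> is_path E p \<and> hd p \<in> A \<and> last p \<in> B"

definition proper_path :: "('v \<times> 'v) set \<Rightarrow> 'v set \<Rightarrow> 'v set \<Rightarrow> 'v list \<Rightarrow> bool" where
  "proper_path E A B p \<longleftrightarrow> path_from_to E A B p \<and> (\<forall>v\<in>set (tl p). v \<notin> A)"

definition causal_path :: "('v \<times> 'v) set \<Rightarrow> 'v list \<Rightarrow> bool" where
  "causal_path E p \<longleftrightarrow> (\<forall>i. Suc i < length p \<longrightarrow> (p ! i, p ! Suc i) \<in> E)"

definition descendants :: "('v \<times> 'v) set \<Rightarrow> 'v set \<Rightarrow> 'v set" where
  "descendants E A = {w. \<exists>a\<in>A. (a, w) \<in> E\<^sup>*}"

definition parents :: "('v \<times> 'v) set \<Rightarrow> 'v \<Rightarrow> 'v set" where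
  "parents E v = {u. (u, v) \<in> E}"

definition collider :: "('v \<times> 'v) set \<Rightarrow> 'v list \<Rightarrow> nat \<Rightarrow> bool" where
  "collider E p j \<longleftrightarrow> 0 < j \<and> Suc j < length p \<and>
     (p ! (j - 1), p ! j) \<in> E \<and> (p ! Suc j, p ! j) \<in> E"

definition d_connecting :: "('v \<times> 'v) set \<Rightarrow> 'v list \<Rightarrow> 'v set \<Rightarrow> bool" where
  "d_connecting E p Z \<longleftrightarrow>
     (\<forall>j. 0 < j \<and> Suc j < length p \<and> \<not> collider E p j \<longrightarrow> p ! j \<notin> Z) \<and>
     (\<forall>j. collider E p j \<longrightarrow> descendants E {p ! j} \<inter> Z \<noteq> {})"

definition blocked :: "('v \<times> 'v) set \<Rightarrow> 'v list \<Rightarrow> 'v set \<Rightarrow> bool" where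
  "blocked E p Z \<longleftrightarrow> \<not> d_connecting E p Z"

definition mediators :: "('v \<times> 'v) set \<Rightarrow> 'v set \<Rightarrow> 'v set \<Rightarrow> 'v set" where
  "mediators E X Y = {p ! i | p i. proper_path E X Y p \<and> causal_path E p \<and> 0 < i \<and> i < length p}"

definition forb :: "('v \<times> 'v) set \<Rightarrow> 'v set \<Rightarrow> 'v set \<Rightarrow> 'v set" where
  "forb E X Y = descendants E (mediators E X Y)"

definition cond_adjustment_criterion ::
  "('v \<times> 'v) set \<Rightarrow> 'v set \<Rightarrow> 'v set \<Rightarrow> 'v set \<Rightarrow> 'v set \<Rightarrow> bool" where
  "cond_adjustment_criterion E X Y Z S \<longleftrightarrow>
     S \<inter> forb E X Y = {} \<and>
     (\<forall>p. proper_path E X Y p \<and> \<not> causal_path E p \<longrightarrow> blocked E p (S \<union> Z))"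

text \<open>Node i takes values in the measure space M i (the dominating measure for its density).
  A joint assignment is a function 'v \<Rightarrow> 'a; the joint density f of all variables in V is
  taken w.r.t. the product measure PiM V M.\<close>

definition is_pos_density :: "'v set \<Rightarrow> ('v \<Rightarrow> 'a measure) \<Rightarrow> (('v \<Rightarrow> 'a) \<Rightarrow> real) \<Rightarrow> bool" where
  "is_pos_density V M f \<longleftrightarrow> f \<in> borel_measurable (PiM V M) \<and>
     (\<forall>v\<in>space (PiM V M). 0 < f v) \<and> (\<integral>\<^sup>+ v. ennreal (f v) \<partial>PiM V M) = 1"

definition marg :: "'v set \<Rightarrow> ('v \<Rightarrow> 'a measure) \<Rightarrow> (('v \<Rightarrow> 'a) \<Rightarrow> real) \<Rightarrow> 'v set
    \<Rightarrow> ('v \<Rightarrow> 'a) \<Rightarrow> ennreal" where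
  "marg V M f A x = (\<integral>\<^sup>+ w. ennreal (f (merge A (V - A) (x, w))) \<partial>PiM (V - A) M)"

definition cond :: "'v set \<Rightarrow> ('v \<Rightarrow> 'a measure) \<Rightarrow> (('v \<Rightarrow> 'a) \<Rightarrow> real) \<Rightarrow> 'v set \<Rightarrow> 'v set
    \<Rightarrow> ('v \<Rightarrow> 'a) \<Rightarrow> ennreal" where
  "cond V M f A B x = marg V M f (A \<union> B) x / marg V M f B x"

text \<open>f is consistent with the causal DAG: the observational member of the compatible family
  factorizes as the product of f(v_i | pa(v_i)).\<close>
definition consistent_with :: "'v set \<Rightarrow> ('v \<times> 'v) set \<Rightarrow> ('v \<Rightarrow> 'a measure)
    \<Rightarrow> (('v \<Rightarrow> 'a) \<Rightarrow> real) \<Rightarrow> bool" where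
  "consistent_with V E M f \<longleftrightarrow> is_pos_density V M f \<and>
     (AE v in PiM V M. ennreal (f v) = (\<Prod>i\<in>V. cond V M f {i} (parents E i) v))"

text \<open>Interventional density f(v | do(x)) of the variables V - X, where v carries the
  intervention values x on X: product of f(v_i | pa(v_i)) over V - X.\<close>
definition do_density :: "'v set \<Rightarrow> ('v \<times> 'v) set \<Rightarrow> ('v \<Rightarrow> 'a measure)
    \<Rightarrow> (('v \<Rightarrow> 'a) \<Rightarrow> real) \<Rightarrow> 'v set \<Rightarrow> ('v \<Rightarrow> 'a) \<Rightarrow> ennreal" where
  "do_density V E M f X v = (\<Prod>i\<in>V - X. cond V M f {i} (parents E i) v)"

definition do_marg :: "'v set \<Rightarrow> ('v \<times> 'v) set \<Rightarrow> ('v \<Rightarrow> 'a measure)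
    \<Rightarrow> (('v \<Rightarrow> 'a) \<Rightarrow> real) \<Rightarrow> 'v set \<Rightarrow> 'v set \<Rightarrow> ('v \<Rightarrow> 'a) \<Rightarrow> ennreal" where
  "do_marg V E M f X A v =
     (\<integral>\<^sup>+ w. do_density V E M f X (merge (X \<union> A) (V - (X \<union> A)) (v, w)) \<partial>PiM (V - (X \<union> A)) M)"

definition do_cond :: "'v set \<Rightarrow> ('v \<times> 'v) set \<Rightarrow> ('v \<Rightarrow> 'a measure)
    \<Rightarrow> (('v \<Rightarrow> 'a) \<Rightarrow> real) \<Rightarrow> 'v set \<Rightarrow> 'v set \<Rightarrow> 'v set \<Rightarrow> ('v \<Rightarrow> 'a) \<Rightarrow> ennreal" where
  "do_cond V E M f X Y Z v = do_marg V E M f X (Y \<union> Z) v / do_marg V E M f X Z v"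

definition cond_adjustment_set :: "'v set \<Rightarrow> ('v \<times> 'v) set \<Rightarrow> ('v \<Rightarrow> 'a measure)
    \<Rightarrow> 'v set \<Rightarrow> 'v set \<Rightarrow> 'v set \<Rightarrow> 'v set \<Rightarrow> bool" where
  "cond_adjustment_set V E M X Y Z S \<longleftrightarrow>
     (\<forall>f. consistent_with V E M f \<longrightarrow>
        (AE v in PiM (X \<union> Y \<union> Z) M.
           do_cond V E M f X Y Z v =
             (if S = {} then cond V M f Y (X \<union> Z) v
              else (\<integral>\<^sup>+ s. cond V M f Y (X \<union> Z \<union> S) (merge (X \<union> Y \<union> Z) S (v, s))
                            * cond V M f S Z (merge (X \<union> Y \<union> Z) S (v, s)) \<partial>PiM S M))))"

end

theory Submission
  imports Defs
begin

text \<open>Fix a value x of X and let the kernels of the mediators read x instead of the variables in X.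
  The resulting hybrid density factorizes over the graph without the edges from X into the mediators.
  It has three kinds of marginals in common with known densities: on Y and Z it agrees with the
  interventional density (no other edge out of X lies on a directed path to Y or Z), on S and Z with
  the observational density (S and Z avoid the forbidden nodes, hence have only unchanged ancestors),
  and, at X = x, with the observational density on every set containing X. In the reduced graph an
  active path from X to Y would be a proper non-causal open path of the original graph, so under the
  hybrid density X and Y are independent given S and Z. Expanding the hybrid density of Y given Z over
  S and inserting X = x into the conditional density of Y gives the adjustment formula.

  All of these are identities between marginals that hold at every point, in the extended
  nonnegative reals; null sets are only discarded to replace the conditional densities by everywhere
  normalised kernels and to divide by finite marginals.\<close>

section \<open>Active walks and d-separation\<close>

text \<open>Nodes may repeat, so a walk can be prolonged edge by edge without checking distinctness;
  \<open>active_walk_imp_proper_path\<close> removes the repetitions afterwards.\<close>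

definition active_walk :: "('v \<times> 'v) set \<Rightarrow> 'v set \<Rightarrow> 'v list \<Rightarrow> bool" where
  "active_walk E W p \<longleftrightarrow> p \<noteq> [] \<and>
     (\<forall>i. Suc i < length p \<longrightarrow> adjacent E (p ! i) (p ! Suc i)) \<and> d_connecting E p W"

lemma descendants_singleton: "descendants E {a} = {w. (a, w) \<in> E\<^sup>*}"
  by (auto simp: descendants_def)

lemma acyclic_asym: "acyclic E \<Longrightarrow> (a, b) \<in> E \<Longrightarrow> (b, a) \<notin> E"
  unfolding acyclic_def by (meson r_into_trancl trancl_trans)

lemma active_walk_singleton: "active_walk E W [x]"
  by (simp add: active_walk_def d_connecting_def collider_def)

text \<open>Only the former endpoint changes status, becoming interior. Premise \<open>inner\<close>
  is its condition as a collider or non-collider, void when \<open>q\<close> is a single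
  node.\<close>

lemma active_walk_snoc:
  assumes q: "active_walk E W q" and adj: "adjacent E (last q) v"
    and inner: "length q \<ge> 2 \<Longrightarrow>
      (if (q ! (length q - 2), last q) \<in> E \<and> (v, last q) \<in> E
       then descendants E {last q} \<inter> W \<noteq> {} else last q \<notin> W)"
  shows "active_walk E W (q @ [v])"
proof -
  have ne: "q \<noteq> []" and la: "last q = q ! (length q - 1)"
    using q by (auto simp: active_walk_def last_conv_nth)
  have "adjacent E ((q @ [v]) ! i) ((q @ [v]) ! Suc i)" if "Suc i < length (q @ [v])" for i
  proof (cases "Suc i < length q")
    case True
    then show ?thesis using q by (simp add: active_walk_def nth_append)
  next
    case False
    with that have "i = length q - 1" "i < length q" "Suc i = length q" using ne by auto
    then show ?thesis using adj la by (simp add: nth_append)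
  qed
  moreover have old: "collider E (q @ [v]) j = collider E q j" if "Suc j < length q" for j
    using that by (auto simp: collider_def nth_append)
  have new: "collider E (q @ [v]) j \<longleftrightarrow>
      (q ! (length q - 2), last q) \<in> E \<and> (v, last q) \<in> E" "length q \<ge> 2" "(q @ [v]) ! j = last q"
    if "\<not> Suc j < length q" "Suc j < length (q @ [v])" "0 < j" for j
  proof -
    have j: "Suc j = length q" "j = length q - 1" using that by auto
    then show "length q \<ge> 2" using that by auto
    have "j - 1 = length q - 2" "j - 1 < length q" "j < length q" using j that by auto
    then show "collider E (q @ [v]) j \<longleftrightarrow>
      (q ! (length q - 2), last q) \<in> E \<and> (v, last q) \<in> E"  "(q @ [v]) ! j = last q"
      using j that la by (auto simp: collider_def nth_append)
  qed
  have "d_connecting E (q @ [v]) W"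
    unfolding d_connecting_def
  proof (intro conjI allI impI; (elim conjE)?)
    fix j assume j: "0 < j" "Suc j < length (q @ [v])" "\<not> collider E (q @ [v]) j"
    show "(q @ [v]) ! j \<notin> W"
    proof (cases "Suc j < length q")
      case True
      then show ?thesis using q j old[OF True] by (auto simp: active_walk_def d_connecting_def nth_append)
    next
      case False
      then show ?thesis using new[OF False j(2) j(1)] inner j by (auto split: if_splits)
    qed
  next
    fix j assume c: "collider E (q @ [v]) j"
    then have j: "0 < j" "Suc j < length (q @ [v])" by (auto simp: collider_def)
    show "descendants E {(q @ [v]) ! j} \<inter> W \<noteq> {}"
    proof (cases "Suc j < length q")
      case True
      then show ?thesis using q c old[OF True] by (auto simp: active_walk_def d_connecting_def nth_append)
    next
      case False
      then show ?thesis using new[OF False j(2) j(1)] inner c by (auto split: if_splits)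
    qed
  qed
  ultimately show ?thesis using ne by (simp add: active_walk_def)
qed

lemma active_walk_drop:
  assumes p: "active_walk E W p" and k: "k < length p"
  shows "active_walk E W (drop k p)"
proof -
  have c: "collider E (drop k p) j \<longleftrightarrow> collider E p (k + j)" if "0 < j" for j
    using that k by (auto simp: collider_def)
  have c0: "collider E (drop k p) j \<Longrightarrow> 0 < j" for j by (simp add: collider_def)
  have "d_connecting E (drop k p) W"
    unfolding d_connecting_def
  proof (intro conjI allI impI; (elim conjE)?)
    fix j assume j: "0 < j" "Suc j < length (drop k p)" "\<not> collider E (drop k p) j"
    then have "\<not> collider E p (k + j)" "0 < k + j" "Suc (k + j) < length p" using c by auto
    then show "drop k p ! j \<notin> W" using p j by (auto simp: active_walk_def d_connecting_def)
  next
    fix j assume j: "collider E (drop k p) j"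
    then have "collider E p (k + j)" using c c0 by blast
    then show "descendants E {drop k p ! j} \<inter> W \<noteq> {}"
      using p k by (auto simp: active_walk_def d_connecting_def)
  qed
  then show ?thesis using p k by (auto simp: active_walk_def)
qed

text \<open>Both outer edges of the stretch point inwards, so the direction must turn at a collider.
  The first one is reached from \<open>p ! i\<close> along forward edges, and it has a descendant in
  \<open>W\<close>.\<close>

lemma active_walk_turning_collider:
  assumes p: "active_walk E W p" and E: "acyclic E"
  shows "\<lbrakk>i < j; j < length p; (p ! i, p ! Suc i) \<in> E; (p ! j, p ! (j - 1)) \<in> E\<rbrakk>
    \<Longrightarrow> descendants E {p ! i} \<inter> W \<noteq> {}"
proof (induction "j - i" arbitrary: i rule: less_induct)
  case less
  have "Suc i \<noteq> j" using less.prems acyclic_asym[OF E] by auto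
  then have ij: "Suc i < j" using less.prems by auto
  have sub: "descendants E {p ! Suc i} \<subseteq> descendants E {p ! i}"
    using less.prems(3) by (auto simp: descendants_singleton intro: converse_rtrancl_into_rtrancl)
  show ?case
  proof (cases "(p ! Suc i, p ! Suc (Suc i)) \<in> E")
    case True
    then have "descendants E {p ! Suc i} \<inter> W \<noteq> {}"
      using less.hyps[of "Suc i"] less.prems ij by auto
    then show ?thesis using sub by blast
  next
    case False
    moreover have "adjacent E (p ! Suc i) (p ! Suc (Suc i))"
      using p ij less.prems by (simp add: active_walk_def)
    ultimately have "collider E p (Suc i)"
      using ij less.prems by (auto simp: collider_def adjacent_def)
    then have "descendants E {p ! Suc i} \<inter> W \<noteq> {}"
      using p by (auto simp: active_walk_def d_connecting_def)
    then show ?thesis using sub by blast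
  qed
qed

text \<open>Cutting out the loop between two visits of a node leaves the status of all other
  remaining positions unchanged; only the junction, whose neighbours now come from different visits,
  needs an argument.\<close>

lemma active_walk_shortcut:
  assumes p: "active_walk E W p" and E: "acyclic E"
    and ij: "i < j" "j < length p" "p ! i = p ! j"
  shows "active_walk E W (take i p @ drop j p)"
proof -
  let ?q = "take i p @ drop j p"
  have len: "length ?q = i + (length p - j)" using ij by auto
  have lo: "?q ! k = p ! k" if "k \<le> i" for k
    using that ij by (auto simp: nth_append)
  have hi: "?q ! k = p ! (k + (j - i))" if "i \<le> k" "k < length ?q" for k
    using that ij by (auto simp: nth_append intro!: arg_cong[where f = "nth p"])
  have adj: "adjacent E (p ! k) (p ! Suc k)" if "Suc k < length p" for k
    using p that by (simp add: active_walk_def)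
  have adjq: "adjacent E (?q ! k) (?q ! Suc k)" if "Suc k < length ?q" for k
  proof (cases "Suc k \<le> i")
    case True
    then show ?thesis using lo[of k] lo[of "Suc k"] adj[of k] ij by auto
  next
    case False
    then have "Suc (k + (j - i)) < length p" using that len ij by linarith
    then show ?thesis using False hi[of k] hi[of "Suc k"] adj[of "k + (j - i)"] that by auto
  qed
  have c: "(0 < k \<and> Suc k < length p \<and> \<not> collider E p k \<longrightarrow> p ! k \<notin> W)"
    "collider E p k \<longrightarrow> descendants E {p ! k} \<inter> W \<noteq> {}" for k
    using p by (auto simp: active_walk_def d_connecting_def)
  have d: "(\<not> collider E ?q k \<longrightarrow> ?q ! k \<notin> W) \<and>
      (collider E ?q k \<longrightarrow> descendants E {?q ! k} \<inter> W \<noteq> {})"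
    if k: "0 < k" "Suc k < length ?q" for k
  proof -
    consider "k < i" | "i < k" | "k = i" by linarith
    then show ?thesis
    proof cases
      case 1
      then have "collider E ?q k \<longleftrightarrow> collider E p k"
        using lo[of k] lo[of "Suc k"] lo[of "k - 1"] k ij unfolding collider_def by auto
      then show ?thesis using c[of k] lo[of k] 1 k ij by auto
    next
      case 2
      let ?m = "k + (j - i)"
      have m: "k - 1 + (j - i) = ?m - 1" using 2 by auto
      have "?q ! (k - 1) = p ! (?m - 1)" "?q ! k = p ! ?m" "?q ! Suc k = p ! Suc ?m"
        using hi[of k] hi[of "Suc k"] hi[of "k - 1"] 2 k m by auto
      moreover have "0 < ?m" "Suc ?m < length p" using k 2 len ij by auto
      ultimately have "collider E ?q k \<longleftrightarrow> collider E p ?m"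
        using k unfolding collider_def by auto
      then show ?thesis using c[of ?m] \<open>?q ! k = p ! ?m\<close> \<open>0 < ?m\<close> \<open>Suc ?m < length p\<close> by auto
    next
      case 3
      have sj: "Suc j < length p" using k 3 len ij by auto
      have q: "?q ! (k - 1) = p ! (i - 1)" "?q ! k = p ! i" "?q ! Suc k = p ! Suc j"
        using lo[of "i - 1"] lo[of i] hi[of "Suc i"] k 3 ij by auto
      have col: "collider E ?q k \<longleftrightarrow> (p ! (i - 1), p ! i) \<in> E \<and> (p ! Suc j, p ! j) \<in> E"
        using k q ij(3) by (auto simp: collider_def)
      \<comment> \<open>One of the two surviving edges does not point into the junction; the visit
        to which it belongs was already a non-collider of \<open>p\<close>.\<close>
      have 1: "p ! i \<notin> W" if "\<not> collider E ?q k"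
      proof (cases "(p ! (i - 1), p ! i) \<in> E")
        case True
        then have "(p ! Suc j, p ! j) \<notin> E" using that col by simp
        then have "\<not> collider E p j" by (simp add: collider_def)
        then show ?thesis using c(1)[of j] ij sj by auto
      next
        case False
        then have "\<not> collider E p i" by (simp add: collider_def)
        then show ?thesis using c(1)[of i] ij k 3 by auto
      qed
      have 2: "descendants E {p ! i} \<inter> W \<noteq> {}" if "collider E ?q k"
      proof (cases "collider E p i \<or> collider E p j")
        case True
        then show ?thesis using c(2)[of i] c(2)[of j] ij by auto
      next
        case False
        \<comment> \<open>Neither visit was a collider although both surviving edges point into the
          node, so both loop edges leave it and the loop has to turn at a collider.\<close>
        with that col have "(p ! Suc i, p ! i) \<notin> E" "(p ! (j - 1), p ! j) \<notin> E"
          using ij sj k 3 by (auto simp: collider_def)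
        moreover have "adjacent E (p ! i) (p ! Suc i)" "adjacent E (p ! (j - 1)) (p ! j)"
          using adj[of i] adj[of "j - 1"] ij by auto
        ultimately have "(p ! i, p ! Suc i) \<in> E" "(p ! j, p ! (j - 1)) \<in> E"
          by (auto simp: adjacent_def)
        then show ?thesis using active_walk_turning_collider[OF p E ij(1,2)] by blast
      qed
      show ?thesis using 1 2 q by simp
    qed
  qed
  then have "d_connecting E ?q W"
    unfolding d_connecting_def by (metis collider_def)
  then show ?thesis using adjq ij by (simp add: active_walk_def)
qed

text \<open>A shortest active walk from \<open>X\<close> to \<open>Y\<close> works: cutting out a
  repetition, or starting at a later visit to \<open>X\<close>, would give a shorter one.\<close>

lemma active_walk_imp_proper_path:
  assumes E: "acyclic E" and p: "active_walk E W p" "hd p \<in> X" "last p \<in> Y"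
  obtains q where "active_walk E W q" "proper_path E X Y q"
proof -
  define P where "P = (\<lambda>q. active_walk E W q \<and> hd q \<in> X \<and> last q \<in> Y)"
  have "P p" using p by (simp add: P_def)
  from ex_has_least_nat[of P, OF this, of length]
  obtain q where q: "P q" and least: "\<And>r. P r \<Longrightarrow> length q \<le> length r" by auto
  have ne: "q \<noteq> []" using q by (simp add: P_def active_walk_def)
  have "distinct q"
  proof (rule ccontr)
    assume "\<not> distinct q"
    then obtain i j where "i < length q" "j < length q" "i \<noteq> j" "q ! i = q ! j"
      by (auto simp: distinct_conv_nth)
    then obtain i j where ij: "i < j" "j < length q" "q ! i = q ! j"
      by (metis linorder_neqE_nat)
    let ?r = "take i q @ drop j q"
    have "hd ?r = hd q" using ij ne
      by (cases "i = 0") (auto simp: hd_append hd_drop_conv_nth hd_conv_nth)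
    then have "P ?r"
      using active_walk_shortcut[OF _ E ij] q ij by (auto simp: P_def)
    from least[OF this] show False using ij by auto
  qed
  moreover have "v \<notin> X" if "v \<in> set (tl q)" for v
  proof
    assume "v \<in> X"
    from that obtain k where k: "k < length (tl q)" "tl q ! k = v" by (auto simp: in_set_conv_nth)
    then have "Suc k < length q" "q ! Suc k = v" by (auto simp: nth_tl)
    then have "P (drop (Suc k) q)"
      using q active_walk_drop[of E W q "Suc k"] \<open>v \<in> X\<close> by (auto simp: P_def hd_drop_conv_nth)
    from least[OF this] show False using ne by (cases q) auto
  qed
  ultimately have "proper_path E X Y q"
    using q by (auto simp: proper_path_def path_from_to_def is_path_def P_def active_walk_def)
  then show ?thesis using that q by (auto simp: P_def)
qed

section \<open>Active walks along directed paths\<close>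

lemma active_walk_snoc_out:
  assumes "acyclic E" "active_walk E W p" "last p \<notin> W" "(last p, v) \<in> E"
  shows "active_walk E W (p @ [v])"
  using assms acyclic_asym[OF assms(1,4)] by (intro active_walk_snoc) (auto simp: adjacent_def)

text \<open>Each node passed on the way down is a descendant of \<open>last p\<close>, hence outside
  \<open>W\<close>, and is left along an outgoing edge, hence a non-collider.\<close>

lemma active_walk_extend_descendant:
  assumes E: "acyclic E" and p: "active_walk E W p" "descendants E {last p} \<inter> W = {}"
    and y: "(last p, y) \<in> E\<^sup>*"
  shows "\<exists>q. active_walk E W q \<and> hd q = hd p \<and> last q = y"
  using y
proof (induction rule: rtrancl_induct)
  case base
  then show ?case using p by blast
next
  case (step b c)
  then obtain q where q: "active_walk E W q" "hd q = hd p" "last q = b" by blast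
  have "b \<notin> W" using step(1) p(2) by (auto simp: descendants_singleton)
  then have "active_walk E W (q @ [c])" using active_walk_snoc_out[OF E q(1)] q step(2) by simp
  moreover have "q \<noteq> []" using q by (simp add: active_walk_def)
  ultimately show ?case using q by (intro exI[of _ "q @ [c]"]) auto
qed

text \<open>The directed path from \<open>u\<close> to \<open>x\<close> is walked backwards. Unless
  \<open>u = x\<close>, the walk reaches \<open>u\<close> from a child, so \<open>u\<close> is a
  non-collider when a parent \<open>v\<close> is appended; this clause also carries the
  induction.\<close>

lemma active_walk_from_descendant:
  assumes E: "acyclic E" and x: "(u, x) \<in> E\<^sup>*"
  shows "descendants E {u} \<inter> W = {} \<Longrightarrow>
    \<exists>q. active_walk E W q \<and> hd q = x \<and> last q = u \<and> (\<forall>v. (v, u) \<in> E \<longrightarrow> active_walk E W (q @ [v]))"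
  using x
proof (induction rule: converse_rtrancl_induct)
  case base
  have "active_walk E W ([x] @ [v])" if "(v, x) \<in> E" for v
    using that by (intro active_walk_snoc) (auto simp: active_walk_singleton adjacent_def)
  then show ?case by (intro exI[of _ "[x]"]) (auto simp: active_walk_singleton)
next
  case (step u u1)
  have "descendants E {u1} \<inter> W = {}" "u \<notin> W"
    using step.prems step.hyps(1)
    by (auto simp: descendants_singleton intro: converse_rtrancl_into_rtrancl)
  then obtain q where q: "active_walk E W q" "hd q = x" "last q = u1" "active_walk E W (q @ [u])"
    using step.IH step.hyps(1) by blast
  have ne: "q \<noteq> []" using q by (simp add: active_walk_def)
  have "(q @ [u]) ! (length (q @ [u]) - 2) = u1"
    using ne q(3) by (simp add: nth_append last_conv_nth)
  then have "active_walk E W ((q @ [u]) @ [v])" if "(v, u) \<in> E" for v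
    using that \<open>u \<notin> W\<close> acyclic_asym[OF E step.hyps(1)] q(4)
    by (intro active_walk_snoc[OF q(4)]) (auto simp: adjacent_def)
  then show ?case using q ne by (intro exI[of _ "q @ [u]"]) auto
qed

text \<open>Provides the set \<open>R\<close> along which \<open>separated_imp_independent\<close>
  splits the factors.\<close>

definition d_reachable :: "('v \<times> 'v) set \<Rightarrow> 'v set \<Rightarrow> 'v set \<Rightarrow> 'v set" where
  "d_reachable E W X = {u. u \<notin> W \<and> (\<exists>p. active_walk E W p \<and> hd p \<in> X \<and> last p = u)}"

text \<open>Members of a family communicate through \<open>i\<close>. Passing from parent to parent
  makes \<open>i\<close> a collider, which is harmless if it has a descendant in \<open>W\<close>.
  Otherwise \<open>i\<close> is an ancestor of \<open>X\<close> or \<open>Y\<close>: descending to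
  \<open>Y\<close> contradicts \<open>sep\<close>, and from a descendant in \<open>X\<close> a walk
  climbs through \<open>i\<close> to the other parent.\<close>

lemma d_reachable_family:
  assumes E: "acyclic E"
    and sep: "\<And>p. active_walk E W p \<Longrightarrow> hd p \<in> X \<Longrightarrow> last p \<notin> Y"
    and i: "descendants E {i} \<inter> (X \<union> Y \<union> W) \<noteq> {}"
    and u: "u \<in> insert i (parents E i)" "u \<in> d_reachable E W X"
    and u': "u' \<in> insert i (parents E i)" "u' \<notin> W"
  shows "u' \<in> d_reachable E W X"
proof -
  obtain p where p: "active_walk E W p" "hd p \<in> X" "last p = u" and uW: "u \<notin> W"
    using u(2) by (auto simp: d_reachable_def)
  have ne: "p \<noteq> []" using p by (simp add: active_walk_def)
  \<comment> \<open>The essential case: a walk has reached \<open>i\<close> and the other member is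
    a parent. Premise \<open>arr\<close> covers both arrivals, through an edge into \<open>i\<close>
    or otherwise with \<open>i\<close> outside \<open>W\<close>.\<close>
  have ?thesis if p': "active_walk E W q" "hd q \<in> X" "last q = i"
    and ui: "u' \<in> parents E i"
    and arr: "length q \<ge> 2 \<Longrightarrow> (q ! (length q - 2), i) \<in> E \<or> i \<notin> W" for q
  proof -
    have ui: "(u', i) \<in> E" using ui by (simp add: parents_def)
    show ?thesis
    proof (cases "descendants E {i} \<inter> W = {}")
      case False
      then have "active_walk E W (q @ [u'])"
        using p' ui arr by (intro active_walk_snoc) (auto simp: adjacent_def)
      moreover have "q \<noteq> []" using p' by (simp add: active_walk_def)
      ultimately show ?thesis using p' u' by (auto simp: d_reachable_def intro!: exI[of _ "q @ [u']"])
    next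
      case True
      with i consider y where "y \<in> Y" "(i, y) \<in> E\<^sup>*" | x where "x \<in> X" "(i, x) \<in> E\<^sup>*"
        by (auto simp: descendants_singleton)
      then show ?thesis
      proof cases
        case 1
        then show ?thesis
          using active_walk_extend_descendant[OF E p'(1), of y] True p' sep by auto
      next
        case 2
        from active_walk_from_descendant[OF E this(2) True]
        obtain r where r: "active_walk E W r" "hd r = x" "active_walk E W (r @ [u'])" using ui by auto
        then have "r \<noteq> []" by (simp add: active_walk_def)
        then show ?thesis using r 2 u' by (auto simp: d_reachable_def intro!: exI[of _ "r @ [u']"])
      qed
    qed
  qed note key = this
  show ?thesis
  proof (cases "u = i")
    case True
    then show ?thesis using key[OF p(1,2)] p(3) uW u' u(2) by auto
  next
    case False
    then have ui: "(u, i) \<in> E" using u(1) by (auto simp: parents_def)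
    then have w: "active_walk E W (p @ [i])" using active_walk_snoc_out[OF E p(1)] p uW by simp
    have "(p @ [i]) ! (length (p @ [i]) - 2) = u"
      using ne p(3) by (simp add: nth_append last_conv_nth)
    then have arr: "((p @ [i]) ! (length (p @ [i]) - 2), i) \<in> E" using ui by simp
    show ?thesis
    proof (cases "u' = i")
      case True
      then show ?thesis using w ne p(2) u' by (auto simp: d_reachable_def intro!: exI[of _ "p @ [i]"])
    next
      case False
      then show ?thesis using key[OF w] arr ne p(2) u' by auto
    qed
  qed
qed

text \<open>Removing the edges from X into the mediators destroys exactly the proper causal paths.\<close>

lemma criterion_imp_no_active_walk:
  assumes E: "acyclic E" and XY: "X \<inter> Y = {}"
    and crit: "\<And>p. proper_path E X Y p \<Longrightarrow> \<not> causal_path E p \<Longrightarrow> blocked E p W"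
    and E': "E' = E - X \<times> mediators E X Y"
    and p: "active_walk E' W p" "hd p \<in> X"
  shows "last p \<notin> Y"
proof
  assume "last p \<in> Y"
  have "acyclic E'" using E E' by (auto intro: acyclic_subset)
  from active_walk_imp_proper_path[OF this p \<open>last p \<in> Y\<close>]
  obtain q where q: "active_walk E' W q" "proper_path E' X Y q" .
  have adj': "adjacent E' (q ! i) (q ! Suc i)" if "Suc i < length q" for i
    using q(1) that by (simp add: active_walk_def)
  \<comment> \<open>By acyclicity adjacent nodes are joined in one direction only, so restoring the
    removed edges creates no new collider on \<open>q\<close>.\<close>
  have orient: "(a, b) \<in> E \<longleftrightarrow> (a, b) \<in> E'" if "adjacent E' a b" for a b
    using that acyclic_asym[OF E] unfolding adjacent_def E' by blast
  have col: "collider E q j \<longleftrightarrow> collider E' q j" for j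
  proof (cases "0 < j \<and> Suc j < length q")
    case True
    then have "adjacent E' (q ! (j - 1)) (q ! j)" "adjacent E' (q ! Suc j) (q ! j)"
      using adj'[of "j - 1"] adj'[of j] by (auto simp: adjacent_def)
    then show ?thesis by (auto simp: collider_def orient)
  qed (auto simp: collider_def)
  have "E'\<^sup>* \<subseteq> E\<^sup>*" by (rule rtrancl_mono) (auto simp: E')
  then have "descendants E' {a} \<subseteq> descendants E {a}" for a by (auto simp: descendants_singleton)
  then have "d_connecting E q W"
    using q(1) unfolding active_walk_def d_connecting_def col by blast
  moreover have pq: "proper_path E X Y q"
    using q(2) unfolding proper_path_def path_from_to_def is_path_def adjacent_def E' by blast
  ultimately have causal: "causal_path E q" using crit by (auto simp: blocked_def)
  have "q \<noteq> []" "hd q \<in> X" "last q \<in> Y"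
    using pq by (auto simp: proper_path_def path_from_to_def is_path_def)
  \<comment> \<open>Disjointness of \<open>X\<close> and \<open>Y\<close> rules out a one-node path.
    The node at index 1 is then a mediator, and the edge from \<open>X\<close> into it was
    removed.\<close>
  then have len: "Suc 0 < length q" using XY
    by (cases q) (auto split: if_splits)
  then have "q ! Suc 0 \<in> mediators E X Y" using pq causal by (auto simp: mediators_def)
  moreover have "(q ! 0, q ! Suc 0) \<in> E'"
    using causal len adj'[of 0] orient by (auto simp: causal_path_def)
  moreover have "q ! 0 \<in> X" using \<open>hd q \<in> X\<close> \<open>q \<noteq> []\<close> by (simp add: hd_conv_nth)
  ultimately show False by (simp add: E')
qed

section \<open>Mediators and forbidden nodes\<close>

lemma mediators_not_source: "mediators E X Y \<inter> X = {}"
proof -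
  have "p ! i \<in> set (tl p)" if "0 < i" "i < length p" for p :: "'v list" and i
    using that by (cases p) (auto simp: nth_Cons' )
  then show ?thesis unfolding mediators_def proper_path_def by blast
qed

text \<open>Acyclicity turns the directed walk from \<open>m\<close> to \<open>y\<close> outside
  \<open>X\<close> into a repetition-free path, to which \<open>x\<close> is prepended.\<close>

lemma mediatorsI:
  assumes E: "acyclic E" and x: "x \<in> X" "(x, m) \<in> E" and my: "(m, y) \<in> (E \<inter> (- X) \<times> (- X))\<^sup>*"
    and m: "m \<notin> X" and y: "y \<in> Y"
  shows "m \<in> mediators E X Y"
proof -
  \<comment> \<open>The reachability clause serves distinctness: a repeated \<open>m\<close> would
    close a directed cycle.\<close>
  have "m \<notin> X \<Longrightarrow> \<exists>p. p \<noteq> [] \<and> hd p = m \<and> last p = y \<and> distinct p \<and> causal_path E p \<and> set p \<inter> X = {}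
      \<and> (\<forall>w\<in>set p. (m, w) \<in> E\<^sup>*)"
    using my
  proof (induction rule: converse_rtrancl_induct)
    case base
    then show ?case by (intro exI[of _ "[y]"]) (auto simp: causal_path_def)
  next
    case (step m m')
    then obtain p where p: "p \<noteq> []" "hd p = m'" "last p = y" "distinct p" "causal_path E p"
        "set p \<inter> X = {}" "\<forall>w\<in>set p. (m', w) \<in> E\<^sup>*" and e: "(m, m') \<in> E" by auto
    have "m \<notin> set p"
      using p(7) e E by (auto simp: acyclic_def dest: rtrancl_into_trancl2)
    moreover have "causal_path E (m # p)"
      using p(1,2,5) e by (auto simp: causal_path_def nth_Cons hd_conv_nth split: nat.split)
    ultimately show ?case
      using p e step.prems by (intro exI[of _ "m # p"]) (auto intro: converse_rtrancl_into_rtrancl)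
  qed
  then obtain p where p: "p \<noteq> []" "hd p = m" "last p = y" "distinct p" "causal_path E p" "set p \<inter> X = {}"
    using m by auto
  have c: "causal_path E (x # p)"
    using p(1,2,5) x by (auto simp: causal_path_def nth_Cons hd_conv_nth split: nat.split)
  then have "is_path E (x # p)"
    using p x by (auto simp: is_path_def causal_path_def adjacent_def)
  then have "proper_path E X Y (x # p)"
    using p x y by (auto simp: proper_path_def path_from_to_def)
  then show ?thesis
    using c p unfolding mediators_def
    by (intro CollectI exI[of _ "x # p"] exI[of _ 1]) (auto simp: hd_conv_nth)
qed

lemma mediators_subset_descendants: "mediators E X Y \<subseteq> descendants E X"
proof
  fix m assume "m \<in> mediators E X Y"
  then obtain p i where p: "proper_path E X Y p" "causal_path E p" "i < length p" "m = p ! i"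
    by (auto simp: mediators_def)
  have "i < length p \<Longrightarrow> (p ! 0, p ! i) \<in> E\<^sup>*" for i
  proof (induction i)
    case (Suc i)
    then show ?case using p(2) by (auto simp: causal_path_def intro: rtrancl_into_rtrancl)
  qed simp
  moreover have "p ! 0 \<in> X"
    using p(1) by (auto simp: proper_path_def path_from_to_def is_path_def hd_conv_nth)
  ultimately show "m \<in> descendants E X" using p(3,4) by (auto simp: descendants_def)
qed

lemma forb_subset_descendants: "forb E X Y \<subseteq> descendants E X"
proof
  fix w assume "w \<in> forb E X Y"
  then obtain m where m: "m \<in> mediators E X Y" "(m, w) \<in> E\<^sup>*"
    by (auto simp: forb_def descendants_def)
  then obtain x where "x \<in> X" "(x, m) \<in> E\<^sup>*"
    using mediators_subset_descendants[of E X Y] by (auto simp: descendants_def)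
  then show "w \<in> descendants E X" using m(2) unfolding descendants_def by (blast intro: rtrancl_trans)
qed

lemma mediators_subset_forb: "mediators E X Y \<subseteq> forb E X Y"
  by (auto simp: forb_def descendants_def)

lemma forb_step: "(u, i) \<in> E \<Longrightarrow> u \<in> forb E X Y \<Longrightarrow> i \<in> forb E X Y"
  by (auto simp: forb_def descendants_def intro: rtrancl_into_rtrancl)

lemma is_dag_subset: "is_dag V E \<Longrightarrow> E' \<subseteq> E \<Longrightarrow> is_dag V E'"
  by (auto simp: is_dag_def intro: acyclic_subset)

section \<open>Marginalization over finite products\<close>

locale sigma_finite_family =
  fixes V :: "'v set" and M :: "'v \<Rightarrow> 'a measure"
  assumes finite_V: "finite V" and sigma_finite: "\<And>i. i \<in> V \<Longrightarrow> sigma_finite_measure (M i)"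
begin

abbreviation "\<Omega> \<equiv> space (PiM V M)"

text \<open>\<open>product_sigma_finite\<close> asks for a sigma-finite measure at every index; off
  \<open>V\<close> a one-point space fills in.\<close>

definition M' :: "'v \<Rightarrow> 'a measure" where
  "M' i = (if i \<in> V then M i else count_space {undefined})"

sublocale M': product_sigma_finite M'
proof (rule product_sigma_finite.intro)
  fix i
  have "sigma_finite_measure (count_space {undefined :: 'a})"
    by (intro sigma_finite_measure_count_space_finite) auto
  then show "sigma_finite_measure (M' i)" by (auto simp: M'_def sigma_finite)
qed

lemma PiM_M': "A \<subseteq> V \<Longrightarrow> PiM A M' = PiM A M"
  by (intro PiM_cong) (auto simp: M'_def)

lemma finite_sub: "A \<subseteq> V \<Longrightarrow> finite A"
  using finite_V by (rule finite_subset[rotated])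

lemma sigma_finite_PiM: "A \<subseteq> V \<Longrightarrow> sigma_finite_measure (PiM A M)"
  using M'.sigma_finite[of A] by (simp add: PiM_M' finite_sub)

lemma nn_integral_PiM_fold:
  assumes "A \<subseteq> V" "B \<subseteq> V" "A \<inter> B = {}" "g \<in> borel_measurable (PiM (A \<union> B) M)"
  shows "(\<integral>\<^sup>+ x. g x \<partial>PiM (A \<union> B) M) = (\<integral>\<^sup>+ x. (\<integral>\<^sup>+ y. g (merge A B (x, y)) \<partial>PiM B M) \<partial>PiM A M)"
  using M'.product_nn_integral_fold[of A B g] assms by (simp add: PiM_M' finite_sub)

lemma AE_PiM_split:
  assumes A: "A \<subseteq> V" "B \<subseteq> V" "A \<inter> B = {}" and Q: "AE x in PiM (A \<union> B) M. Q x"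
  shows "AE x in PiM A M. AE y in PiM B M. Q (merge A B (x, y))"
proof -
  interpret pair_sigma_finite "PiM A M" "PiM B M"
    using A by (simp add: pair_sigma_finite_def sigma_finite_PiM)
  have "distr (PiM A M \<Otimes>\<^sub>M PiM B M) (PiM (A \<union> B) M) (merge A B) = PiM (A \<union> B) M"
    using M'.distr_merge[of A B] A by (simp add: PiM_M' finite_sub)
  then have "AE x in distr (PiM A M \<Otimes>\<^sub>M PiM B M) (PiM (A \<union> B) M) (merge A B). Q x"
    using Q by metis
  then have "AE z in PiM A M \<Otimes>\<^sub>M PiM B M. Q (merge A B z)"
    by (rule AE_distrD[OF measurable_merge])
  then show ?thesis by (rule AE_pair)
qed

text \<open>The cylinder over a null set is null by Tonelli, even over a factor of infinite measure,
  because the inner integral of 0 is 0.\<close>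

lemma AE_PiM_lift:
  assumes A: "A \<subseteq> V" and P: "AE u in PiM A M. P u"
    and Q: "\<And>v. v \<in> \<Omega> \<Longrightarrow> P (restrict v A) \<Longrightarrow> Q v"
  shows "AE v in PiM V M. Q v"
proof -
  have V: "A \<union> (V - A) = V" using A by auto
  obtain N where N: "N \<in> null_sets (PiM A M)" "{u \<in> space (PiM A M). \<not> P u} \<subseteq> N"
    using P unfolding eventually_ae_filter by blast
  have r: "(\<lambda>v. restrict v A) \<in> measurable (PiM V M) (PiM A M)"
    using A by (rule measurable_restrict_subset)
  let ?N = "(\<lambda>v. restrict v A) -` N \<inter> \<Omega>"
  have meas: "?N \<in> sets (PiM V M)" using N(1) by (intro measurable_sets[OF r]) auto
  have ind: "(\<lambda>v. indicator N (restrict v A) :: ennreal) \<in> borel_measurable (PiM (A \<union> (V - A)) M)"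
    using N(1) r unfolding V by (intro measurable_compose[OF r] borel_measurable_indicator) auto
  have "emeasure (PiM V M) ?N = (\<integral>\<^sup>+ v. indicator N (restrict v A) \<partial>PiM V M)"
    by (subst nn_integral_indicator[symmetric, OF meas], rule nn_integral_cong)
       (auto simp: indicator_def)
  also have "\<dots> = (\<integral>\<^sup>+ x. (\<integral>\<^sup>+ y. indicator N (restrict (merge A (V - A) (x, y)) A)
      \<partial>PiM (V - A) M) \<partial>PiM A M)"
    using nn_integral_PiM_fold[OF A _ _ ind] unfolding V by auto
  also have "\<dots> = (\<integral>\<^sup>+ x. (\<integral>\<^sup>+ y. indicator N x \<partial>PiM (V - A) M) \<partial>PiM A M)"
  proof (intro nn_integral_cong)
    fix x y assume "x \<in> space (PiM A M)"
    then have "restrict (merge A (V - A) (x, y)) A = x"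
      by (auto simp: merge_def space_PiM PiE_def extensional_def)
    then show "indicator N (restrict (merge A (V - A) (x, y)) A) = (indicator N x :: ennreal)"
      by simp
  qed
  also have "\<dots> = 0"
  proof -
    have "AE x in PiM A M. (\<integral>\<^sup>+ y. indicator N x \<partial>PiM (V - A) M) = (0 :: ennreal)"
      using AE_not_in[OF N(1)] by (rule eventually_mono) simp
    then show ?thesis by (simp add: nn_integral_cong_AE[where v = "\<lambda>_. 0"])
  qed
  finally have null: "?N \<in> null_sets (PiM V M)" using meas by auto
  show ?thesis
  proof (rule AE_I'[OF null], rule subsetI)
    fix v assume "v \<in> {v \<in> \<Omega>. \<not> Q v}"
    then have v: "v \<in> \<Omega>" "\<not> P (restrict v A)" using Q by blast+
    then show "v \<in> ?N" using N(2) measurable_space[OF r v(1)] by auto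
  qed
qed

lemma merge_in_space: "A \<subseteq> V \<Longrightarrow> v \<in> \<Omega> \<Longrightarrow> w \<in> space (PiM A M) \<Longrightarrow> merge (V - A) A (v, w) \<in> \<Omega>"
  by (auto simp: merge_def space_PiM PiE_def Pi_def extensional_def)

lemma measurable_merge_PiM:
  assumes A: "A \<subseteq> V"
  shows "merge (V - A) A \<in> measurable (PiM V M \<Otimes>\<^sub>M PiM A M) (PiM V M)"
proof -
  have "(\<lambda>x. merge (V - A) A (restrict (fst x) (V - A), snd x))
      \<in> measurable (PiM V M \<Otimes>\<^sub>M PiM A M) (PiM ((V - A) \<union> A) M)"
    by (intro measurable_compose[OF _ measurable_merge] measurable_Pair
        measurable_compose[OF measurable_fst measurable_restrict_subset]) auto
  moreover have "merge (V - A) A (restrict (fst x) (V - A), snd x) = merge (V - A) A x" for x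
    by (cases x) (auto simp: merge_def)
  moreover have "(V - A) \<union> A = V" using A by auto
  ultimately show ?thesis by simp
qed

text \<open>The result stays a function of full assignments, so marginals on different sets can be
  multiplied and compared at one point. \<open>integ (V - T) g\<close> is the marginal of
  \<open>g\<close> on \<open>T\<close>.\<close>

definition integ :: "'v set \<Rightarrow> (('v \<Rightarrow> 'a) \<Rightarrow> ennreal) \<Rightarrow> ('v \<Rightarrow> 'a) \<Rightarrow> ennreal" where
  "integ A g v = (\<integral>\<^sup>+ w. g (merge (V - A) A (v, w)) \<partial>PiM A M)"

definition depends_on :: "(('v \<Rightarrow> 'a) \<Rightarrow> 'b) \<Rightarrow> 'v set \<Rightarrow> bool" where
  "depends_on g B \<longleftrightarrow> (\<forall>v\<in>\<Omega>. \<forall>w\<in>\<Omega>. (\<forall>i\<in>B. v i = w i) \<longrightarrow> g v = g w)"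

lemma depends_onD: "depends_on g B \<Longrightarrow> v \<in> \<Omega> \<Longrightarrow> w \<in> \<Omega> \<Longrightarrow> (\<And>i. i \<in> B \<Longrightarrow> v i = w i) \<Longrightarrow> g v = g w"
  unfolding depends_on_def by metis

lemma depends_on_mono: "depends_on g B \<Longrightarrow> B \<subseteq> C \<Longrightarrow> depends_on g C"
  unfolding depends_on_def by (meson subsetD)

lemma depends_on_V: "depends_on g V"
  unfolding depends_on_def space_PiM by (metis PiE_ext)

lemma depends_on_prod: "(\<And>i. i \<in> I \<Longrightarrow> depends_on (h i) B) \<Longrightarrow> depends_on (\<lambda>v. \<Prod>i\<in>I. h i v) B"
  unfolding depends_on_def by (intro ballI impI prod.cong refl) metis

lemma measurable_integ:
  assumes A: "A \<subseteq> V" and g: "g \<in> borel_measurable (PiM V M)"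
  shows "integ A g \<in> borel_measurable (PiM V M)"
proof -
  interpret sigma_finite_measure "PiM A M" using A by (rule sigma_finite_PiM)
  have "(\<lambda>x. g (merge (V - A) A x)) \<in> borel_measurable (PiM V M \<Otimes>\<^sub>M PiM A M)"
    using measurable_compose[OF measurable_merge_PiM[OF A] g] .
  then show ?thesis unfolding integ_def by (intro borel_measurable_nn_integral) (simp add: case_prod_beta')
qed

lemma measurable_merge_section:
  assumes A: "A \<subseteq> V" and g: "g \<in> borel_measurable (PiM V M)" and v: "v \<in> \<Omega>"
  shows "(\<lambda>w. g (merge (V - A) A (v, w))) \<in> borel_measurable (PiM A M)"
  using measurable_compose[OF measurable_Pair1'[OF v] measurable_compose[OF measurable_merge_PiM[OF A] g]] .

lemma integ_cong:
  assumes "A \<subseteq> V" "v \<in> \<Omega>"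
    and "\<And>w. w \<in> \<Omega> \<Longrightarrow> (\<And>i. i \<in> V - A \<Longrightarrow> w i = v i) \<Longrightarrow> g w = h w"
  shows "integ A g v = integ A h v"
  unfolding integ_def
  using assms by (intro nn_integral_cong assms(3) merge_in_space) (auto simp: merge_def)

lemma integ_Un:
  assumes A: "A \<subseteq> V" "B \<subseteq> V" "A \<inter> B = {}" and g: "g \<in> borel_measurable (PiM V M)" and v: "v \<in> \<Omega>"
  shows "integ (A \<union> B) g v = integ A (integ B g) v"
proof -
  have AB: "A \<union> B \<subseteq> V" using A by auto
  have "integ (A \<union> B) g v = (\<integral>\<^sup>+ x. (\<integral>\<^sup>+ y.
      g (merge (V - (A \<union> B)) (A \<union> B) (v, merge A B (x, y))) \<partial>PiM B M) \<partial>PiM A M)"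
    unfolding integ_def
    by (rule nn_integral_PiM_fold[OF A(1,2,3) measurable_merge_section[OF AB g v]])
  also have "\<dots> = integ A (integ B g) v"
  proof -
    have "merge (V - (A \<union> B)) (A \<union> B) (v, merge A B (x, y))
        = merge (V - B) B (merge (V - A) A (v, x), y)" for x y
      using A by (auto simp: merge_def fun_eq_iff)
    then show ?thesis by (simp add: integ_def)
  qed
  finally show ?thesis .
qed

lemma integ_empty:
  assumes "v \<in> \<Omega>"
  shows "integ {} g v = g v"
proof -
  have "merge (V - {}) {} (v, w) = v" for w
    using assms by (auto simp: merge_def space_PiM PiE_def extensional_def)
  then show ?thesis
    by (simp add: integ_def PiM_empty nn_integral_count_space_finite)
qed

lemma integ_mult:
  assumes A: "A \<subseteq> V" and h: "depends_on h (V - A)" and g: "g \<in> borel_measurable (PiM V M)"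
    and v: "v \<in> \<Omega>"
  shows "integ A (\<lambda>w. h w * g w) v = h v * integ A g v"
proof -
  have "integ A (\<lambda>w. h w * g w) v = integ A (\<lambda>w. h v * g w) v"
    using A v by (intro integ_cong arg_cong2[where f = times] depends_onD[OF h]) auto
  then show ?thesis
    unfolding integ_def using measurable_merge_section[OF A g v] by (simp add: nn_integral_cmult)
qed

lemma depends_on_integ:
  assumes A: "A \<subseteq> V" and g: "depends_on g D"
  shows "depends_on (integ A g) (D - A)"
  unfolding depends_on_def
proof (intro ballI impI)
  fix v w assume v: "v \<in> \<Omega>" "w \<in> \<Omega>" and eq: "\<forall>i\<in>D - A. v i = w i"
  show "integ A g v = integ A g w"
    unfolding integ_def
  proof (intro nn_integral_cong depends_onD[OF g] merge_in_space A v)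
    fix x i assume "i \<in> D"
    then show "merge (V - A) A (v, x) i = merge (V - A) A (w, x) i"
      using eq by (auto simp: merge_def)
  qed
qed

text \<open>The coordinates of \<open>v\<close> in \<open>A\<close> are overwritten, so the split
  into \<open>V - A\<close> and \<open>A\<close> can be lifted back to \<open>V\<close>.\<close>

lemma AE_merge:
  assumes A: "A \<subseteq> V" and Q: "AE v in PiM V M. Q v"
  shows "AE v in PiM V M. AE w in PiM A M. Q (merge (V - A) A (v, w))"
proof -
  have V: "(V - A) \<union> A = V" using A by auto
  have "AE u in PiM (V - A) M. AE w in PiM A M. Q (merge (V - A) A (u, w))"
    by (rule AE_PiM_split) (use A Q in \<open>auto simp only: V\<close>)
  then show ?thesis
  proof (rule AE_PiM_lift[rotated])
    fix v assume *: "AE w in PiM A M. Q (merge (V - A) A (restrict v (V - A), w))"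
    have "merge (V - A) A (restrict v (V - A), w) = merge (V - A) A (v, w)" for w
      by (auto simp: merge_def)
    then show "AE w in PiM A M. Q (merge (V - A) A (v, w))" using * by simp
  qed auto
qed

lemma AE_integ_cong:
  assumes A: "A \<subseteq> V" and Q: "AE v in PiM V M. g v = h v"
  shows "AE v in PiM V M. integ A g v = integ A h v"
  using AE_merge[OF assms] unfolding integ_def by (rule eventually_mono) (rule nn_integral_cong_AE)

lemma integ_V:
  assumes v: "v \<in> \<Omega>"
  shows "integ V g v = (\<integral>\<^sup>+ w. g w \<partial>PiM V M)"
  unfolding integ_def
proof (rule nn_integral_cong)
  fix w assume "w \<in> \<Omega>"
  then have "merge (V - V) V (v, w) = w" by (auto simp: merge_def space_PiM PiE_def extensional_def)
  then show "g (merge (V - V) V (v, w)) = g w" by simp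
qed

lemma AE_integ_finite:
  assumes A: "A \<subseteq> V" and g: "g \<in> borel_measurable (PiM V M)" and fin: "(\<integral>\<^sup>+ w. g w \<partial>PiM V M) < \<infinity>"
  shows "AE v in PiM V M. integ A g v < \<infinity>"
proof -
  have V: "(V - A) \<union> A = V" using A by auto
  interpret A: sigma_finite_measure "PiM A M" using A by (rule sigma_finite_PiM)
  let ?G = "\<lambda>u. \<integral>\<^sup>+ w. g (merge (V - A) A (u, w)) \<partial>PiM A M"
  have "(\<lambda>x. g (merge (V - A) A x)) \<in> borel_measurable (PiM (V - A) M \<Otimes>\<^sub>M PiM A M)"
    by (rule measurable_compose[OF measurable_merge]) (simp only: V g)
  then have meas: "?G \<in> borel_measurable (PiM (V - A) M)"
    by (intro A.borel_measurable_nn_integral) (simp add: case_prod_beta')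
  have "(\<integral>\<^sup>+ u. ?G u \<partial>PiM (V - A) M) = (\<integral>\<^sup>+ w. g w \<partial>PiM V M)"
    using nn_integral_PiM_fold[of "V - A" A g] A g unfolding V by (metis Diff_disjoint Diff_subset Int_commute)
  then have "AE u in PiM (V - A) M. ?G u \<noteq> \<infinity>"
    using fin meas by (intro nn_integral_PInf_AE) (simp_all only: less_irrefl infinity_ennreal_def less_top)
  then show ?thesis
  proof (rule AE_PiM_lift[rotated])
    fix v assume *: "?G (restrict v (V - A)) \<noteq> \<infinity>"
    have "merge (V - A) A (restrict v (V - A), w) = merge (V - A) A (v, w)" for w
      by (auto simp: merge_def)
    then show "integ A g v < \<infinity>" using * by (simp add: integ_def less_top)
  qed auto
qed

text \<open>If the integral vanished, a positive function would be 0 almost everywhere on the factor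
  \<open>A\<close>; this factor, and hence the whole product, would be null.\<close>

lemma integ_pos:
  assumes A: "A \<subseteq> V" and g: "g \<in> borel_measurable (PiM V M)" and pos: "\<And>v. v \<in> \<Omega> \<Longrightarrow> 0 < g v"
    and ne: "emeasure (PiM V M) \<Omega> \<noteq> 0" and v: "v \<in> \<Omega>"
  shows "0 < integ A g v"
proof (rule ccontr)
  assume "\<not> 0 < integ A g v"
  then have "(\<integral>\<^sup>+ w. g (merge (V - A) A (v, w)) \<partial>PiM A M) = 0" by (simp add: integ_def)
  then have "AE w in PiM A M. g (merge (V - A) A (v, w)) = 0"
    using measurable_merge_section[OF A g v] by (simp add: nn_integral_0_iff_AE)
  then have "AE w in PiM A M. False"
  proof (rule AE_mp, intro AE_I2 impI)
    fix w assume "w \<in> space (PiM A M)" "g (merge (V - A) A (v, w)) = 0"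
    then show False using pos[OF merge_in_space[OF A v]] by (metis less_irrefl)
  qed
  then have "AE w in PiM V M. False" by (rule AE_PiM_lift[OF A]) auto
  then show False using ne by (auto simp: AE_iff_null null_sets_def)
qed

end

section \<open>Products of Markov kernels\<close>

context sigma_finite_family
begin

text \<open>Normalisation at every point, rather than almost everywhere, makes the elimination of
  nodes a pointwise identity.\<close>

definition markov_kernels :: "('v \<times> 'v) set \<Rightarrow> 'v set \<Rightarrow> ('v \<Rightarrow> ('v \<Rightarrow> 'a) \<Rightarrow> ennreal) \<Rightarrow> bool" where
  "markov_kernels E C h \<longleftrightarrow> (\<forall>i\<in>C. h i \<in> borel_measurable (PiM V M) \<and>
     depends_on (h i) (insert i (parents E i)) \<and> (\<forall>v\<in>\<Omega>. integ {i} (h i) v = 1))"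

lemma markov_kernels_subset: "markov_kernels E C h \<Longrightarrow> D \<subseteq> C \<Longrightarrow> markov_kernels E D h"
  by (auto simp: markov_kernels_def)

lemma measurable_prod_kernels:
  "markov_kernels E C h \<Longrightarrow> (\<lambda>v. \<Prod>i\<in>C. h i v) \<in> borel_measurable (PiM V M)"
  by (intro borel_measurable_prod_ennreal) (auto simp: markov_kernels_def)

text \<open>The nodes outside \<open>A\<close> are eliminated one at a time, always a sink: its
  variable occurs in no other remaining kernel, and its own kernel integrates to 1.\<close>

lemma integ_prod_ancestral:
  assumes E: "is_dag V E" and A: "\<And>i. i \<in> A \<Longrightarrow> parents E i \<inter> C \<subseteq> A"
    and h: "markov_kernels E C h" and C: "A \<subseteq> C" "C \<subseteq> V" and v: "v \<in> \<Omega>"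
  shows "integ (C - A) (\<lambda>v. \<Prod>i\<in>C. h i v) v = (\<Prod>i\<in>A. h i v)"
  using A h C v
proof (induction "card (C - A)" arbitrary: C v)
  case 0
  then have "C - A = {}" using finite_sub[of C] by simp
  then have "C = A" using 0 by blast
  then show ?case using 0 by (simp add: integ_empty)
next
  case (Suc n)
  have EV: "E \<subseteq> V \<times> V" and "acyclic E" using E by (auto simp: is_dag_def)
  moreover have "finite E" using EV finite_V by (meson finite_SigmaI finite_subset)
  ultimately have wf: "wf (E\<inverse>)" by (intro finite_acyclic_wf_converse)
  have "C - A \<noteq> {}" using Suc(2) by (metis card.empty nat.distinct(1))
  \<comment> \<open>Minimality for the converse relation gives a node without children in
    \<open>C - A\<close>; it has none in \<open>A\<close> either, because \<open>A\<close> contains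
    the parents in \<open>C\<close> of its nodes.\<close>
  then obtain i where i: "i \<in> C - A" "\<And>j. (j, i) \<in> E\<inverse> \<Longrightarrow> j \<notin> C - A"
    using wfE_min'[OF wf] by metis
  let ?C = "C - {i}"
  have nochild: "i \<notin> parents E j" if "j \<in> C" for j
    using i that Suc.prems(1)[of j] by (auto simp: parents_def)
  have C: "?C \<subseteq> V" "i \<in> V" "finite C" using Suc.prems i finite_sub by auto
  have hC: "markov_kernels E ?C h" using Suc.prems(2) by (rule markov_kernels_subset) auto
  have dep: "depends_on (\<lambda>v. \<Prod>j\<in>?C. h j v) (V - {i})"
  proof (intro depends_on_prod)
    fix j assume j: "j \<in> ?C"
    then have "depends_on (h j) (insert j (parents E j))"
      using hC by (auto simp: markov_kernels_def)
    then show "depends_on (h j) (V - {i})"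
      using nochild[of j] j C EV by (elim depends_on_mono) (auto simp: parents_def)
  qed
  have hi: "h i \<in> borel_measurable (PiM V M)" "\<And>w. w \<in> \<Omega> \<Longrightarrow> integ {i} (h i) w = 1"
    using Suc.prems(2) i by (auto simp: markov_kernels_def)
  have eq: "(\<Prod>j\<in>C. h j v) = (\<Prod>j\<in>?C. h j v) * h i v" for v
    using prod.remove[of C i "\<lambda>j. h j v"] C i by (simp add: mult.commute)
  have CA: "C - A = (?C - A) \<union> {i}" using i by auto
  have "integ (C - A) (\<lambda>v. \<Prod>j\<in>C. h j v) v
      = integ (?C - A) (integ {i} (\<lambda>v. \<Prod>j\<in>C. h j v)) v"
    using C Suc.prems unfolding CA
    by (intro integ_Un measurable_prod_kernels[OF Suc.prems(2)]) auto
  also have "\<dots> = integ (?C - A) (\<lambda>v. \<Prod>j\<in>?C. h j v) v"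
  proof (rule integ_cong)
    fix w assume w: "w \<in> \<Omega>"
    show "integ {i} (\<lambda>v. \<Prod>j\<in>C. h j v) w = (\<Prod>j\<in>?C. h j w)"
      unfolding eq using integ_mult[OF _ dep hi(1) w] hi(2)[OF w] C by simp
  qed (use C Suc.prems in auto)
  also have "\<dots> = (\<Prod>i\<in>A. h i v)"
  proof (rule Suc.hyps(1))
    have "card (C - A - {i}) = n" using Suc(2) i C by (simp add: card_Diff_singleton)
    moreover have "C - A - {i} = ?C - A" by auto
    ultimately show "n = card (?C - A)" by simp
  qed (use Suc.prems C i hC in auto)
  finally show ?case .
qed

text \<open>The kernels outside \<open>A\<close> are integrated to 1 first, so a marginal on nodes
  of the parent-closed set \<open>A\<close> involves only the kernels of \<open>A\<close>.\<close>

lemma integ_prod_reduce: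
  assumes E: "is_dag V E" and A: "\<And>i. i \<in> A \<Longrightarrow> parents E i \<inter> C \<subseteq> A"
    and h: "markov_kernels E C h" and C: "A \<subseteq> C" "C \<subseteq> V" and v: "v \<in> \<Omega>"
    and B: "C - A \<subseteq> B" "B \<subseteq> V"
  shows "integ B (\<lambda>v. \<Prod>i\<in>C. h i v) v = integ (B - (C - A)) (\<lambda>v. \<Prod>i\<in>A. h i v) v"
proof -
  have "B = (B - (C - A)) \<union> (C - A)" using B by auto
  then have "integ B (\<lambda>v. \<Prod>i\<in>C. h i v) v
      = integ (B - (C - A)) (integ (C - A) (\<lambda>v. \<Prod>i\<in>C. h i v)) v"
    using integ_Un[of "B - (C - A)" "C - A" "\<lambda>v. \<Prod>i\<in>C. h i v" v] B C v measurable_prod_kernels[OF h]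
    by auto
  also have "\<dots> = integ (B - (C - A)) (\<lambda>v. \<Prod>i\<in>A. h i v) v"
    using B v by (intro integ_cong integ_prod_ancestral[OF E A h C]) auto
  finally show ?thesis .
qed

text \<open>Families of ancestral nodes lie, up to W, either inside R or outside R, so the ancestral
  product splits into a factor in R and W and a factor in the complement of R.\<close>

lemma separated_imp_independent:
  assumes E: "is_dag V E" and h: "markov_kernels E V h"
    and sub: "X \<subseteq> V" "Y \<subseteq> V" "W \<subseteq> V"
    and XY: "X \<inter> Y = {}" "X \<inter> W = {}" "Y \<inter> W = {}"
    and R: "X \<subseteq> R" "R \<inter> Y = {}" "R \<inter> W = {}"
    and closed: "\<And>i u u'. descendants E {i} \<inter> (X \<union> Y \<union> W) \<noteq> {} \<Longrightarrow> u \<in> insert i (parents E i) \<Longrightarrow>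
      u \<in> R \<Longrightarrow> u' \<in> insert i (parents E i) \<Longrightarrow> u' \<notin> W \<Longrightarrow> u' \<in> R"
    and v: "v \<in> \<Omega>"
  defines "p \<equiv> (\<lambda>v. \<Prod>i\<in>V. h i v)"
  shows "integ (V - (X \<union> Y \<union> W)) p v * integ (V - W) p v
    = integ (V - (Y \<union> W)) p v * integ (V - (X \<union> W)) p v"
proof -
  let ?fam = "\<lambda>i. insert i (parents E i)"
  define A where "A = {i \<in> V. descendants E {i} \<inter> (X \<union> Y \<union> W) \<noteq> {}}"
  define A1 where "A1 = {i \<in> A. ?fam i \<inter> R \<noteq> {}}"
  define A2 where "A2 = {i \<in> A. ?fam i \<inter> R = {}}"
  define a where "a = (\<lambda>v. \<Prod>i\<in>A1. h i v)"
  define b where "b = (\<lambda>v. \<Prod>i\<in>A2. h i v)"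
  have EV: "E \<subseteq> V \<times> V" using E by (simp add: is_dag_def)
  have AV: "A \<subseteq> V" by (auto simp: A_def)
  have XYWA: "X \<union> Y \<union> W \<subseteq> A" using sub by (auto simp: A_def descendants_singleton)
  have anc: "parents E i \<inter> V \<subseteq> A" if "i \<in> A" for i
  proof
    fix u assume "u \<in> parents E i \<inter> V"
    then have u: "(u, i) \<in> E" "u \<in> V" by (auto simp: parents_def)
    then have "descendants E {i} \<subseteq> descendants E {u}"
      by (auto simp: descendants_singleton intro: converse_rtrancl_into_rtrancl)
    then show "u \<in> A" using that u(2) by (auto simp: A_def)
  qed
  have ab: "(\<Prod>i\<in>A. h i v) = a v * b v" for v
  proof -
    have "A = A1 \<union> A2" "A1 \<inter> A2 = {}" by (auto simp: A1_def A2_def)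
    then show ?thesis
      using finite_sub[OF AV] by (simp add: a_def b_def prod.union_disjoint)
  qed
  have hm: "markov_kernels E A1 h" "markov_kernels E A2 h"
    using AV by (auto intro: markov_kernels_subset[OF h] simp: A1_def A2_def)
  then have meas: "a \<in> borel_measurable (PiM V M)" "b \<in> borel_measurable (PiM V M)"
    unfolding a_def b_def by (auto intro: measurable_prod_kernels)
  have depb: "depends_on b (V - R)"
    unfolding b_def
  proof (rule depends_on_prod)
    fix i assume i: "i \<in> A2"
    then have "?fam i \<subseteq> V - R" using EV by (auto simp: A2_def A_def parents_def)
    then show "depends_on (h i) (V - R)"
      using hm(2) i by (elim depends_on_mono[rotated]) (auto simp: markov_kernels_def)
  qed
  \<comment> \<open>Once \<open>T\<close> contains \<open>W\<close>, the variables of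
    \<open>A - T - R\<close> do not occur in \<open>a\<close>, which lives on \<open>R\<close> and
    \<open>W\<close>, and those of \<open>R\<close> do not occur in \<open>b\<close>; the integral
    factors.\<close>
  have split: "integ (V - T) p v = integ ((A - T) \<inter> R) a v * integ (A - T - R) b v"
    if T: "W \<subseteq> T" "T \<subseteq> X \<union> Y \<union> W" for T
  proof -
    have "integ (V - T) p v = integ (V - T - (V - A)) (\<lambda>v. \<Prod>i\<in>A. h i v) v"
      unfolding p_def using XYWA T AV v by (intro integ_prod_reduce[OF E anc h]) auto
    also have "V - T - (V - A) = (A - T) \<inter> R \<union> (A - T - R)" using AV by auto
    also have "integ \<dots> (\<lambda>v. \<Prod>i\<in>A. h i v) v
        = integ ((A - T) \<inter> R) (integ (A - T - R) (\<lambda>v. a v * b v)) v"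
      unfolding ab using AV meas v by (intro integ_Un) auto
    also have "\<dots> = integ ((A - T) \<inter> R) (\<lambda>v. integ (A - T - R) b v * a v) v"
    proof (rule integ_cong)
      fix w assume w: "w \<in> \<Omega>"
      have "depends_on a (V - (A - T - R))"
        unfolding a_def
      proof (rule depends_on_prod)
        fix i assume i: "i \<in> A1"
        then have "?fam i \<subseteq> R \<union> W" "?fam i \<subseteq> V"
          using closed[of i] EV AV by (auto simp: A1_def A_def parents_def)
        then have "?fam i \<subseteq> V - (A - T - R)" using T by auto
        then show "depends_on (h i) (V - (A - T - R))"
          using hm(1) i by (elim depends_on_mono[rotated]) (auto simp: markov_kernels_def)
      qed
      then show "integ (A - T - R) (\<lambda>v. a v * b v) w = integ (A - T - R) b w * a w"
        using integ_mult[OF _ _ meas(2) w, of "A - T - R" a] AV by (auto simp: mult.commute)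
    qed (use AV v in auto)
    also have "\<dots> = integ (A - T - R) b v * integ ((A - T) \<inter> R) a v"
    proof (rule integ_mult)
      have "depends_on (integ (A - T - R) b) (V - R - (A - T - R))"
        using AV by (intro depends_on_integ[OF _ depb]) auto
      then show "depends_on (integ (A - T - R) b) (V - (A - T) \<inter> R)"
        by (rule depends_on_mono) auto
    qed (use AV v meas in auto)
    finally show ?thesis by (simp add: mult.commute)
  qed
  \<comment> \<open>As \<open>Y\<close> misses \<open>R\<close>, adding \<open>Y\<close> to
    \<open>T\<close> leaves the first factor unchanged; as \<open>X\<close> lies in
    \<open>R\<close>, adding \<open>X\<close> leaves the second unchanged. The four marginals share
    two values of each factor, so the cross products agree.\<close>
  have s: "(A - (X \<union> Y \<union> W)) \<inter> R = (A - (X \<union> W)) \<inter> R" "(A - W) \<inter> R = (A - (Y \<union> W)) \<inter> R"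
    "A - (X \<union> Y \<union> W) - R = A - (Y \<union> W) - R" "A - (X \<union> W) - R = A - W - R"
    using R by auto
  have "integ (V - (X \<union> Y \<union> W)) p v * integ (V - W) p v =
    (integ ((A - (X \<union> W)) \<inter> R) a v * integ (A - (Y \<union> W) - R) b v) *
    (integ ((A - (Y \<union> W)) \<inter> R) a v * integ (A - W - R) b v)"
    using split[of "X \<union> Y \<union> W"] split[of W] by (simp add: s)
  also have "\<dots> = integ (V - (Y \<union> W)) p v * integ (V - (X \<union> W)) p v"
  proof -
    have "Y \<union> W \<subseteq> X \<union> Y \<union> W" "X \<union> W \<subseteq> X \<union> Y \<union> W" by auto
    then show ?thesis
      by (simp only: split[of "Y \<union> W"] split[of "X \<union> W"] s(4) Un_upper2 mult.commute mult.left_commute)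
  qed
  finally show ?thesis .
qed

end

section \<open>The hybrid density\<close>

context sigma_finite_family
begin

text \<open>The mediator kernels read the value of X from x0 rather than from the argument, so the
  product of these kernels factorizes over the graph without edges from X into the mediators, and
  it agrees with the original product wherever the argument equals x0 on X.\<close>

definition hybrid_kernel :: "'v set \<Rightarrow> 'v set \<Rightarrow> ('v \<Rightarrow> 'a) \<Rightarrow> ('v \<Rightarrow> ('v \<Rightarrow> 'a) \<Rightarrow> ennreal)
    \<Rightarrow> 'v \<Rightarrow> ('v \<Rightarrow> 'a) \<Rightarrow> ennreal" where
  "hybrid_kernel X Med x0 K i v =
     (if i \<in> Med then K i (merge (V - X) X (v, restrict x0 X)) else K i v)"

lemma restrict_in_space: "A \<subseteq> V \<Longrightarrow> v \<in> \<Omega> \<Longrightarrow> restrict v A \<in> space (PiM A M)"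
  by (auto simp: space_PiM)

lemma hybrid_kernel_eq:
  assumes "X \<subseteq> V" "v \<in> \<Omega>" "\<And>j. j \<in> X \<Longrightarrow> v j = x0 j"
  shows "hybrid_kernel X Med x0 K i v = K i v"
proof -
  have "merge (V - X) X (v, restrict x0 X) = v"
    using assms by (auto simp: merge_def space_PiM PiE_def extensional_def fun_eq_iff)
  then show ?thesis by (simp add: hybrid_kernel_def)
qed

text \<open>Overwriting \<open>X\<close> by \<open>x0\<close> removes the dependence on parents in
  \<open>X\<close>. As \<open>Med\<close> is disjoint from \<open>X\<close>, the overwriting
  commutes with integrating over the node itself, so normalisation survives.\<close>

lemma markov_kernels_hybrid:
  assumes E: "is_dag V E" and K: "markov_kernels E V K" and X: "X \<subseteq> V" "Med \<inter> X = {}"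
    and x0: "x0 \<in> \<Omega>"
  shows "markov_kernels (E - X \<times> Med) V (hybrid_kernel X Med x0 K)"
  unfolding markov_kernels_def
proof (intro ballI conjI)
  have EV: "E \<subseteq> V \<times> V" using E by (simp add: is_dag_def)
  let ?s = "\<lambda>v. merge (V - X) X (v, restrict x0 X)"
  have rx: "restrict x0 X \<in> space (PiM X M)" using X x0 by (intro restrict_in_space)
  have s: "?s \<in> measurable (PiM V M) (PiM V M)"
    using measurable_compose[OF measurable_Pair2'[OF rx] measurable_merge_PiM[OF X(1)]] .
  have sp: "?s v \<in> \<Omega>" if "v \<in> \<Omega>" for v using X rx that by (intro merge_in_space)
  fix i assume i: "i \<in> V"
  have Ki: "K i \<in> borel_measurable (PiM V M)" "depends_on (K i) (insert i (parents E i))"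
    "\<And>v. v \<in> \<Omega> \<Longrightarrow> integ {i} (K i) v = 1"
    using K i by (auto simp: markov_kernels_def)
  show "hybrid_kernel X Med x0 K i \<in> borel_measurable (PiM V M)"
  proof (cases "i \<in> Med")
    case True
    then show ?thesis unfolding hybrid_kernel_def using measurable_compose[OF s Ki(1)] by simp
  next
    case False
    then show ?thesis unfolding hybrid_kernel_def using Ki(1) by simp
  qed
  show "depends_on (hybrid_kernel X Med x0 K i) (insert i (parents (E - X \<times> Med) i))"
    unfolding depends_on_def
  proof (intro ballI impI)
    fix v w assume v: "v \<in> \<Omega>" "w \<in> \<Omega>"
      and eq: "\<forall>j\<in>insert i (parents (E - X \<times> Med) i). v j = w j"
    show "hybrid_kernel X Med x0 K i v = hybrid_kernel X Med x0 K i w"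
    proof (cases "i \<in> Med")
      case True
      have "K i (?s v) = K i (?s w)"
      proof (rule depends_onD[OF Ki(2) sp[OF v(1)] sp[OF v(2)]])
        fix j assume "j \<in> insert i (parents E i)"
        then show "?s v j = ?s w j" using eq by (auto simp: merge_def parents_def)
      qed
      then show ?thesis using True by (simp add: hybrid_kernel_def)
    next
      case False
      have "K i v = K i w"
      proof (rule depends_onD[OF Ki(2) v])
        fix j assume "j \<in> insert i (parents E i)"
        then show "v j = w j" using eq False by (auto simp: parents_def)
      qed
      then show ?thesis using False by (simp add: hybrid_kernel_def)
    qed
  qed
  fix v assume v: "v \<in> \<Omega>"
  show "integ {i} (hybrid_kernel X Med x0 K i) v = 1"
  proof (cases "i \<in> Med")
    case True
    then have "i \<notin> X" using X by auto
    have "integ {i} (hybrid_kernel X Med x0 K i) v = integ {i} (K i) (?s v)"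
      unfolding integ_def
    proof (intro nn_integral_cong)
      fix w
      have "?s (merge (V - {i}) {i} (v, w)) = merge (V - {i}) {i} (?s v, w)"
        using \<open>i \<notin> X\<close> i X by (auto simp: merge_def fun_eq_iff)
      then show "hybrid_kernel X Med x0 K i (merge (V - {i}) {i} (v, w))
          = K i (merge (V - {i}) {i} (?s v, w))"
        using True by (simp add: hybrid_kernel_def)
    qed
    then show ?thesis using Ki(3)[OF sp[OF v]] by simp
  next
    case False
    then have "hybrid_kernel X Med x0 K i = K i" by (auto simp: hybrid_kernel_def)
    then show ?thesis using Ki(3)[OF v] by simp
  qed
qed

section \<open>Marginals of the hybrid density\<close>

context
  fixes E :: "('v \<times> 'v) set" and K :: "'v \<Rightarrow> ('v \<Rightarrow> 'a) \<Rightarrow> ennreal" and X Y Z S :: "'v set"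
    and x0 :: "'v \<Rightarrow> 'a"
  assumes E: "is_dag V E" and K: "markov_kernels E V K"
    and sub: "X \<subseteq> V" "Y \<subseteq> V" "Z \<subseteq> V" "S \<subseteq> V"
    and disj: "X \<inter> Y = {}" "X \<inter> Z = {}" "X \<inter> S = {}" "Y \<inter> Z = {}" "Y \<inter> S = {}" "Z \<inter> S = {}"
    and Z: "Z \<inter> descendants E X = {}"
    and crit: "cond_adjustment_criterion E X Y Z S"
    and x0: "x0 \<in> \<Omega>"
begin

definition hybrid :: "('v \<Rightarrow> 'a) \<Rightarrow> ennreal" where
  "hybrid v = (\<Prod>i\<in>V. hybrid_kernel X (mediators E X Y) x0 K i v)"

lemma dag': "is_dag V (E - X \<times> mediators E X Y)"
  using E by (rule is_dag_subset) auto

lemma markov': "markov_kernels (E - X \<times> mediators E X Y) V (hybrid_kernel X (mediators E X Y) x0 K)"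
  by (rule markov_kernels_hybrid[OF E K sub(1) mediators_not_source x0])

lemma measurable_hybrid: "hybrid \<in> borel_measurable (PiM V M)"
  using measurable_prod_kernels[OF markov'] by (simp add: hybrid_def[abs_def])

text \<open>Nodes with a directed path to Y or Z avoiding X are not in X, and their parents in X are
  cut off in the hybrid graph because Z contains no descendant of X.\<close>

lemma hybrid_eq_do:
  assumes T: "T \<subseteq> Y \<union> Z" and v: "v \<in> \<Omega>" "\<And>i. i \<in> X \<Longrightarrow> v i = x0 i"
  shows "integ (V - (X \<union> T)) (\<lambda>v. \<Prod>i\<in>V - X. K i v) v = integ (V - T) hybrid v"
proof -
  \<comment> \<open>Closed under parents within \<open>V - X\<close> in the original graph and, by
    \<open>cut\<close>, under all parents in the hybrid graph; both sides reduce to the kernels of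
    \<open>A\<close>.\<close>
  define A where "A = {i \<in> V - X. \<exists>t\<in>Y \<union> Z. (i, t) \<in> (E \<inter> (- X) \<times> (- X))\<^sup>*}"
  have EV: "E \<subseteq> V \<times> V" and acyc: "acyclic E" using E by (auto simp: is_dag_def)
  have A: "A \<subseteq> V - X" "Y \<union> Z \<subseteq> A" using sub disj by (auto simp: A_def)
  have anc: "u \<in> A" if "i \<in> A" "u \<in> parents E i" "u \<notin> X" for i u
    using that EV by (auto simp: A_def parents_def intro!: converse_rtrancl_into_rtrancl)
  have cut: "u \<notin> X" if i: "i \<in> A" and u: "u \<in> parents (E - X \<times> mediators E X Y) i" for i u
  proof
    assume uX: "u \<in> X"
    have ui: "(u, i) \<in> E" "i \<notin> mediators E X Y" using u uX by (auto simp: parents_def)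
    obtain t where t: "t \<in> Y \<union> Z" "(i, t) \<in> (E \<inter> (- X) \<times> (- X))\<^sup>*" "i \<notin> X"
      using i by (auto simp: A_def)
    have "(i, t) \<in> E\<^sup>*" using t(2) rtrancl_mono[of "E \<inter> (- X) \<times> (- X)" E] by auto
    then have "t \<in> descendants E X"
      using uX ui(1) unfolding descendants_def by (blast intro: converse_rtrancl_into_rtrancl)
    then have "t \<in> Y" using t(1) Z by auto
    then show False using mediatorsI[OF acyc uX ui(1) t(2,3)] ui(2) by simp
  qed
  have "integ (V - (X \<union> T)) (\<lambda>v. \<Prod>i\<in>V - X. K i v) v
      = integ (V - (X \<union> T) - (V - X - A)) (\<lambda>v. \<Prod>i\<in>A. K i v) v"
    using A T v by (intro integ_prod_reduce[OF E] markov_kernels_subset[OF K]) (auto intro: anc)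
  also have "V - (X \<union> T) - (V - X - A) = V - T - (V - A)" using A by auto
  also have "integ (V - T - (V - A)) (\<lambda>v. \<Prod>i\<in>A. K i v) v
      = integ (V - T - (V - A)) (\<lambda>v. \<Prod>i\<in>A. hybrid_kernel X (mediators E X Y) x0 K i v) v"
  \<comment> \<open>The integration leaves the coordinates in \<open>X\<close> at \<open>x0\<close>,
    where hybrid and original kernels agree.\<close>
  proof (intro integ_cong prod.cong refl)
    fix w i assume "w \<in> \<Omega>" "\<And>i. i \<in> V - (V - T - (V - A)) \<Longrightarrow> w i = v i"
    then have "w j = x0 j" if "j \<in> X" for j
      using v(2)[OF that] sub(1) A(1) that by (metis DiffE DiffI subsetD)
    then show "K i w = hybrid_kernel X (mediators E X Y) x0 K i w"
      using sub(1) \<open>w \<in> \<Omega>\<close> by (intro hybrid_kernel_eq[symmetric])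
  qed (use v in auto)
  also have "\<dots> = integ (V - T) hybrid v"
    unfolding hybrid_def using A T v
    by (intro integ_prod_reduce[OF dag' _ markov', symmetric])
       (auto intro: anc cut simp: parents_def dest: cut[unfolded parents_def])
  finally show ?thesis .
qed

text \<open>Forbidden nodes are closed under descendants and contain the mediators, so their
  complement is closed under parents and carries unchanged kernels. It contains \<open>S\<close> by
  the criterion and \<open>Z\<close> because \<open>Z\<close> avoids the descendants of
  \<open>X\<close>. The values of \<open>v\<close> on \<open>X\<close> are arbitrary here.\<close>

lemma hybrid_eq_nondescendants:
  assumes T: "T \<subseteq> S \<union> Z" and v: "v \<in> \<Omega>"
  shows "integ (V - T) hybrid v = integ (V - T) (\<lambda>v. \<Prod>i\<in>V. K i v) v"
proof -
  define N where "N = V - forb E X Y"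
  have T': "T \<subseteq> N"
    using T crit Z forb_subset_descendants[of E X Y] sub
    unfolding N_def cond_adjustment_criterion_def by blast
  have anc: "parents E i \<inter> V \<subseteq> N" if "i \<in> N" for i
    using that by (auto simp: N_def parents_def dest: forb_step)
  have "integ (V - T) hybrid v
      = integ (V - T - (V - N)) (\<lambda>v. \<Prod>i\<in>N. hybrid_kernel X (mediators E X Y) x0 K i v) v"
    unfolding hybrid_def
  proof (rule integ_prod_reduce[OF dag' _ markov'])
    fix i assume "i \<in> N"
    then show "parents (E - X \<times> mediators E X Y) i \<inter> V \<subseteq> N" using anc by (auto simp: parents_def)
  qed (use v T' in \<open>auto simp: N_def\<close>)
  also have "\<dots> = integ (V - T - (V - N)) (\<lambda>v. \<Prod>i\<in>N. K i v) v"
    using mediators_subset_forb[of E X Y] v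
    by (intro integ_cong prod.cong) (auto simp: N_def hybrid_kernel_def)
  also have "\<dots> = integ (V - T) (\<lambda>v. \<Prod>i\<in>V. K i v) v"
    using T' v by (intro integ_prod_reduce[OF E anc K, symmetric]) (auto simp: N_def)
  finally show ?thesis .
qed

lemma hybrid_eq_at:
  assumes T: "X \<subseteq> T" and v: "v \<in> \<Omega>" "\<And>i. i \<in> X \<Longrightarrow> v i = x0 i"
  shows "integ (V - T) hybrid v = integ (V - T) (\<lambda>v. \<Prod>i\<in>V. K i v) v"
  unfolding hybrid_def
proof (intro integ_cong prod.cong refl)
  fix w i assume w: "w \<in> \<Omega>" "\<And>i. i \<in> V - (V - T) \<Longrightarrow> w i = v i"
  then have "w j = x0 j" if "j \<in> X" for j
    using v(2)[OF that] sub(1) T that by (metis DiffD2 DiffI subsetD)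
  then show "hybrid_kernel X (mediators E X Y) x0 K i w = K i w"
    using sub(1) w(1) by (intro hybrid_kernel_eq)
qed (use v in auto)

text \<open>Independence of \<open>X\<close> and \<open>Y\<close> given \<open>S \<union> Z\<close>,
  cross-multiplied so that infinite marginals need no separate treatment. The splitting set consists
  of the nodes reachable from \<open>X\<close> in the reduced graph.\<close>

lemma hybrid_independent:
  assumes v: "v \<in> \<Omega>"
  shows "integ (V - (X \<union> Y \<union> (S \<union> Z))) hybrid v * integ (V - (S \<union> Z)) hybrid v
    = integ (V - (Y \<union> (S \<union> Z))) hybrid v * integ (V - (X \<union> (S \<union> Z))) hybrid v"
proof -
  let ?E = "E - X \<times> mediators E X Y" and ?W = "S \<union> Z"
  have acyc: "acyclic E" "acyclic ?E" using E dag' by (auto simp: is_dag_def)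
  have sep: "last p \<notin> Y" if "active_walk ?E ?W p" "hd p \<in> X" for p
    using criterion_imp_no_active_walk[OF acyc(1) disj(1) _ refl that] crit
    by (auto simp: cond_adjustment_criterion_def)
  have "X \<subseteq> d_reachable ?E ?W X"
  proof
    fix x assume "x \<in> X"
    then show "x \<in> d_reachable ?E ?W X"
      using disj active_walk_singleton[of ?E ?W x]
      by (auto simp: d_reachable_def intro!: exI[of _ "[x]"])
  qed
  moreover have "d_reachable ?E ?W X \<inter> Y = {}" "d_reachable ?E ?W X \<inter> ?W = {}"
    using sep by (auto simp: d_reachable_def)
  moreover have "S \<union> Z \<subseteq> V" "X \<inter> ?W = {}" "Y \<inter> ?W = {}" using sub disj by blast+
  ultimately show ?thesis
    unfolding hybrid_def
    using d_reachable_family[OF acyc(2) sep]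
    by (intro separated_imp_independent[OF dag' markov' sub(1,2) _ disj(1) _ _ _ _ _ _ v])
qed

end

end

section \<open>The adjustment formula\<close>

lemma marg_cong: "(\<And>i. i \<in> A \<Longrightarrow> x i = y i) \<Longrightarrow> marg V M f A x = marg V M f A y"
proof -
  assume "\<And>i. i \<in> A \<Longrightarrow> x i = y i"
  then have "merge A (V - A) (x, w) = merge A (V - A) (y, w)" for w by (auto simp: merge_def)
  then show ?thesis by (simp add: marg_def)
qed

lemma cond_cong: "(\<And>i. i \<in> A \<union> B \<Longrightarrow> x i = y i) \<Longrightarrow> cond V M f A B x = cond V M f A B y"
  unfolding cond_def by (intro arg_cong2[where f = divide] marg_cong) auto

lemma do_marg_cong:
  "(\<And>i. i \<in> X \<union> A \<Longrightarrow> x i = y i) \<Longrightarrow> do_marg V E M f X A x = do_marg V E M f X A y"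
proof -
  assume "\<And>i. i \<in> X \<union> A \<Longrightarrow> x i = y i"
  then have "merge (X \<union> A) (V - (X \<union> A)) (x, w) = merge (X \<union> A) (V - (X \<union> A)) (y, w)" for w
    by (auto simp: merge_def)
  then show ?thesis by (simp add: do_marg_def)
qed

lemma ennreal_cross_divide:
  fixes a b c d :: ennreal
  assumes "a * b = c * d" and "b \<noteq> 0" "b \<noteq> top" "d \<noteq> 0" "d \<noteq> top"
  shows "a / d = c / b"
proof -
  have "a = c * d / b" using assms by (metis mult_divide_eq_ennreal)
  then have "a / d = c / b * d / d" by (simp add: divide_ennreal_def mult.commute mult.left_commute)
  then show ?thesis using assms by (simp add: mult_divide_eq_ennreal)
qed

context sigma_finite_family
begin

text \<open>No factor is null when the whole product is not, so an almost sure statement without the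
  variable is true.\<close>

lemma AE_PiM_const:
  assumes A: "A \<subseteq> V" and ne: "emeasure (PiM V M) \<Omega> \<noteq> 0" and P: "AE w in PiM A M. P"
  shows "P"
proof (rule ccontr)
  assume "\<not> P"
  then have "AE w in PiM V M. False" using P by (intro AE_PiM_lift[OF A]) auto
  then show False using ne by (auto simp: AE_iff_null null_sets_def)
qed

lemma marg_eq_integ: "A \<subseteq> V \<Longrightarrow> marg V M f A v = integ (V - A) (\<lambda>v. ennreal (f v)) v"
  by (simp add: marg_def integ_def double_diff)

lemma do_marg_eq_integ:
  "X \<union> A \<subseteq> V \<Longrightarrow> do_marg V E M f X A v = integ (V - (X \<union> A)) (do_density V E M f X) v"
  by (simp only: do_marg_def integ_def double_diff[OF _ order_refl])

section \<open>Marginals of a positive density\<close>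

context
  fixes f :: "('v \<Rightarrow> 'a) \<Rightarrow> real"
  assumes f: "is_pos_density V M f"
begin

lemma measurable_density: "(\<lambda>v. ennreal (f v)) \<in> borel_measurable (PiM V M)"
  using f by (auto simp: is_pos_density_def)

lemma density_integral: "(\<integral>\<^sup>+ v. ennreal (f v) \<partial>PiM V M) = 1"
  using f by (simp add: is_pos_density_def)

lemma emeasure_space_nonzero: "emeasure (PiM V M) \<Omega> \<noteq> 0"
proof
  assume "emeasure (PiM V M) \<Omega> = 0"
  then have "AE v in PiM V M. ennreal (f v) = 0" by (auto simp: AE_iff_null intro: null_setsI AE_I')
  then have "(\<integral>\<^sup>+ v. ennreal (f v) \<partial>PiM V M) = (\<integral>\<^sup>+ v. 0 \<partial>PiM V M)" by (rule nn_integral_cong_AE)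
  then show False using density_integral by simp
qed

lemma marg_pos: "A \<subseteq> V \<Longrightarrow> v \<in> \<Omega> \<Longrightarrow> 0 < marg V M f A v"
  unfolding marg_eq_integ
  by (intro integ_pos measurable_density emeasure_space_nonzero)
     (use f in \<open>auto simp: is_pos_density_def\<close>)

lemma measurable_marg: "A \<subseteq> V \<Longrightarrow> marg V M f A \<in> borel_measurable (PiM V M)"
  using measurable_integ[OF _ measurable_density, of "V - A"] marg_eq_integ[of A f]
  by (simp add: fun_eq_iff cong: measurable_cong_simp)

lemma AE_marg_finite: "A \<subseteq> V \<Longrightarrow> AE v in PiM V M. marg V M f A v < \<infinity>"
  unfolding marg_eq_integ
  by (intro AE_integ_finite measurable_density) (auto simp: density_integral)

lemma integ_marg:
  assumes "A \<subseteq> V" "B \<subseteq> A" "v \<in> \<Omega>"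
  shows "integ B (marg V M f A) v = marg V M f (A - B) v"
proof -
  have D: "V - (A - B) = B \<union> (V - A)" "A - B \<subseteq> V" "B \<subseteq> V" "B \<inter> (V - A) = {}"
    using assms by auto
  have "marg V M f (A - B) v = integ B (integ (V - A) (\<lambda>v. ennreal (f v))) v"
    unfolding marg_eq_integ[OF D(2)] D(1)
    by (rule integ_Un[OF D(3) Diff_subset D(4) measurable_density assms(3)])
  also have "integ (V - A) (\<lambda>v. ennreal (f v)) = marg V M f A"
    using assms(1) marg_eq_integ[of A f] by auto
  finally show ?thesis by simp
qed

section \<open>Normalised conditional kernels\<close>

context
  fixes E :: "('v \<times> 'v) set"
  assumes E: "is_dag V E"
begin

text \<open>A version of the conditional densities that integrates to 1 at every point: where the
  marginal of the parents is infinite, the quotient would be a junk value.\<close>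

definition kernel :: "'v \<Rightarrow> ('v \<Rightarrow> 'a) \<Rightarrow> ennreal" where
  "kernel i v = (if marg V M f (parents E i) v < \<infinity> then cond V M f {i} (parents E i) v
     else marg V M f {i} v)"

lemma parents_facts: "i \<in> V \<Longrightarrow> parents E i \<subseteq> V" "i \<notin> parents E i"
  using E by (auto simp: is_dag_def parents_def dest: acyclic_asym)

lemma markov_kernels_kernel: "markov_kernels E V kernel"
  unfolding markov_kernels_def
proof (intro ballI conjI)
  fix i assume i: "i \<in> V"
  note pa = parents_facts(1)[OF i] parents_facts(2)[of i]
  have [measurable]: "marg V M f (parents E i) \<in> borel_measurable (PiM V M)"
    "marg V M f ({i} \<union> parents E i) \<in> borel_measurable (PiM V M)"
    "marg V M f {i} \<in> borel_measurable (PiM V M)"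
    using pa i by (auto intro!: measurable_marg)
  show "kernel i \<in> borel_measurable (PiM V M)"
    unfolding kernel_def[abs_def] cond_def[abs_def] by measurable
  show "depends_on (kernel i) (insert i (parents E i))"
    unfolding depends_on_def
  proof (intro ballI impI)
    fix v w :: "'v \<Rightarrow> 'a" assume eq: "\<forall>j\<in>insert i (parents E i). v j = w j"
    have "marg V M f (parents E i) v = marg V M f (parents E i) w"
      "cond V M f {i} (parents E i) v = cond V M f {i} (parents E i) w"
      "marg V M f {i} v = marg V M f {i} w"
      using eq by (auto intro!: marg_cong cond_cong)
    then show "kernel i v = kernel i w" by (simp add: kernel_def)
  qed
  fix v assume v: "v \<in> \<Omega>"
  \<comment> \<open>No node is its own parent, so integrating over \<open>i\<close> stays in one
    branch of \<open>kernel\<close> with a constant denominator.\<close>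
  have same: "marg V M f (parents E i) w = marg V M f (parents E i) v"
    if "\<And>j. j \<in> V - {i} \<Longrightarrow> w j = v j" for w
    using that pa by (intro marg_cong) auto
  show "integ {i} (kernel i) v = 1"
  proof (cases "marg V M f (parents E i) v < \<infinity>")
    case True
    let ?c = "marg V M f (parents E i) v"
    have "integ {i} (kernel i) v = integ {i} (\<lambda>w. inverse ?c * marg V M f (insert i (parents E i)) w) v"
    proof (rule integ_cong)
      fix w assume "\<And>j. j \<in> V - {i} \<Longrightarrow> w j = v j"
      then show "kernel i w = inverse ?c * marg V M f (insert i (parents E i)) w"
        using same[of w] True by (simp add: kernel_def cond_def divide_ennreal_def mult.commute)
    qed (use i v in auto)
    also have "\<dots> = inverse ?c * integ {i} (marg V M f (insert i (parents E i))) v"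
      using i pa v by (intro integ_mult) (auto simp: depends_on_def intro!: measurable_marg)
    also have "integ {i} (marg V M f (insert i (parents E i))) v = ?c"
      using integ_marg[of "insert i (parents E i)" "{i}" v] i pa v by simp
    also have "inverse ?c * ?c = 1"
      using True marg_pos[OF pa(1) v] ennreal_divide_self[of ?c]
      by (simp add: divide_ennreal_def mult.commute)
    finally show ?thesis .
  next
    case False
    have "integ {i} (kernel i) v = integ {i} (marg V M f {i}) v"
    proof (rule integ_cong)
      fix w assume "\<And>j. j \<in> V - {i} \<Longrightarrow> w j = v j"
      then show "kernel i w = marg V M f {i} w"
        using same[of w] False by (simp add: kernel_def)
    qed (use i v in auto)
    also have "\<dots> = 1"
      using integ_marg[of "{i}" "{i}" v] marg_eq_integ[of "{}" f v] integ_V[OF v] density_integral i v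
      by simp
    finally show ?thesis .
  qed
qed

lemma kernel_pos:
  assumes i: "i \<in> V" and v: "v \<in> \<Omega>"
  shows "0 < kernel i v"
  using parents_facts(1)[OF i] i marg_pos[OF _ v, of "insert i (parents E i)"] marg_pos[OF _ v, of "{i}"]
  by (auto simp: kernel_def cond_def divide_ennreal_def ennreal_zero_less_mult_iff ennreal_inverse_positive)

lemma AE_cond_eq_kernel: "AE v in PiM V M. \<forall>i\<in>V. cond V M f {i} (parents E i) v = kernel i v"
proof (rule AE_finite_allI[OF finite_V])
  fix i assume "i \<in> V"
  from AE_marg_finite[OF parents_facts(1)[OF this]]
  show "AE v in PiM V M. cond V M f {i} (parents E i) v = kernel i v"
    by (rule eventually_mono) (simp add: kernel_def)
qed

end

end

text \<open>All functions live on \<open>V\<close>, so \<open>integ\<close> applies throughout. The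
  factor 1 covers the empty \<open>S\<close>, where \<open>integ S\<close> changes nothing.\<close>

lemma cond_adjustment_AE:
  fixes E :: "('v \<times> 'v) set" and X Y Z S :: "'v set"
  assumes E: "is_dag V E"
    and sub: "X \<subseteq> V" "Y \<subseteq> V" "Z \<subseteq> V" "S \<subseteq> V"
    and disj: "X \<inter> Y = {}" "X \<inter> Z = {}" "X \<inter> S = {}" "Y \<inter> Z = {}" "Y \<inter> S = {}" "Z \<inter> S = {}"
    and Z: "Z \<inter> descendants E X = {}"
    and crit: "cond_adjustment_criterion E X Y Z S"
    and f: "consistent_with V E M f"
  shows "AE v in PiM V M. do_cond V E M f X Y Z v =
    integ S (\<lambda>v. cond V M f Y (X \<union> Z \<union> S) v * (if S = {} then 1 else cond V M f S Z v)) v"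
proof -
  have pos: "is_pos_density V M f"
    and fac: "AE v in PiM V M. ennreal (f v) = (\<Prod>i\<in>V. cond V M f {i} (parents E i) v)"
    using f by (auto simp: consistent_with_def)
  define K where "K = kernel f E"
  have K: "markov_kernels E V K" unfolding K_def by (rule markov_kernels_kernel[OF pos E])
  define p where "p = (\<lambda>v. \<Prod>i\<in>V. K i v)"
  \<comment> \<open>\<open>m T\<close> and \<open>d T\<close> are the observational and
    interventional marginals on \<open>T\<close> formed with the normalised kernels; they agree
    almost everywhere with \<open>marg\<close> and \<open>do_marg\<close>.\<close>
  define m where "m = (\<lambda>T. integ (V - T) p)"
  define d where "d = (\<lambda>T. integ (V - (X \<union> T)) (\<lambda>v. \<Prod>i\<in>V - X. K i v))"
  have AEK: "AE v in PiM V M. \<forall>i\<in>V. cond V M f {i} (parents E i) v = K i v"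
    unfolding K_def by (rule AE_cond_eq_kernel[OF pos E])
  have fp: "AE v in PiM V M. ennreal (f v) = p v"
    using fac AEK by eventually_elim (simp add: p_def)
  have pm: "p \<in> borel_measurable (PiM V M)" unfolding p_def by (rule measurable_prod_kernels[OF K])
  have p1: "(\<integral>\<^sup>+ v. p v \<partial>PiM V M) = 1"
    using nn_integral_cong_AE[OF fp] density_integral[OF pos] by simp
  have m_eq: "AE v in PiM V M. marg V M f T v = m T v" if "T \<subseteq> V" for T
    unfolding marg_eq_integ[OF that] m_def by (rule AE_integ_cong[OF _ fp]) auto
  have m_fin: "AE v in PiM V M. m T v < \<infinity>" if "T \<subseteq> V" for T
    unfolding m_def by (rule AE_integ_finite[OF _ pm]) (auto simp: p1)
  have ppos: "0 < p v" if v: "v \<in> \<Omega>" for v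
  proof -
    have "0 < (\<Prod>i\<in>I. K i v)" if "I \<subseteq> V" for I
      using finite_sub[OF that] that
      by (induction rule: finite_induct)
         (auto simp: ennreal_zero_less_mult_iff K_def kernel_pos[OF pos E _ v])
    then show ?thesis by (simp add: p_def)
  qed
  have m_pos: "0 < m T v" if "v \<in> \<Omega>" for T v
    unfolding m_def using that
    by (intro integ_pos[OF _ pm ppos emeasure_space_nonzero[OF pos]]) auto
  have d_eq: "AE v in PiM V M. do_marg V E M f X T v = d T v" if "X \<union> T \<subseteq> V" for T
  proof -
    have "AE v in PiM V M. do_density V E M f X v = (\<Prod>i\<in>V - X. K i v)"
      using AEK by eventually_elim (simp add: do_density_def)
    then show ?thesis
      unfolding do_marg_eq_integ[OF that] d_def by (intro AE_integ_cong) auto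
  qed
  note ctx = E K sub disj Z crit
  \<comment> \<open>Where \<open>X\<close> takes the values of \<open>x0\<close>, the observational
    density of \<open>Y\<close> given \<open>X\<close>, \<open>Z\<close>, \<open>S\<close> equals
    the hybrid density of \<open>Y\<close> given \<open>S\<close>, \<open>Z\<close>: the shared
    marginals are inserted into \<open>hybrid_independent\<close>.\<close>
  have key: "m (Y \<union> (X \<union> Z \<union> S)) v / m (X \<union> Z \<union> S) v
      = integ (V - (Y \<union> (S \<union> Z))) (hybrid E K X Y x0) v / m (S \<union> Z) v"
    if x0: "x0 \<in> \<Omega>" and v: "v \<in> \<Omega>" "\<And>i. i \<in> X \<Longrightarrow> v i = x0 i"
      and fin: "m (X \<union> Z \<union> S) v < \<infinity>" "m (S \<union> Z) v < \<infinity>" for x0 v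
  proof (rule ennreal_cross_divide)
    have u: "X \<union> Y \<union> (S \<union> Z) = Y \<union> (X \<union> Z \<union> S)" "X \<union> (S \<union> Z) = X \<union> Z \<union> S" by auto
    have "m (Y \<union> (X \<union> Z \<union> S)) v = integ (V - (X \<union> Y \<union> (S \<union> Z))) (hybrid E K X Y x0) v"
      "m (X \<union> Z \<union> S) v = integ (V - (X \<union> (S \<union> Z))) (hybrid E K X Y x0) v"
      unfolding u m_def p_def using v
      by (intro hybrid_eq_at[OF ctx x0, symmetric]; auto)+
    moreover have "m (S \<union> Z) v = integ (V - (S \<union> Z)) (hybrid E K X Y x0) v"
      unfolding m_def p_def by (rule hybrid_eq_nondescendants[OF ctx x0 order_refl v(1), symmetric])
    ultimately show "m (Y \<union> (X \<union> Z \<union> S)) v * m (S \<union> Z) v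
        = integ (V - (Y \<union> (S \<union> Z))) (hybrid E K X Y x0) v * m (X \<union> Z \<union> S) v"
      using hybrid_independent[OF ctx x0 v(1)] by simp
  next
    show "m (X \<union> Z \<union> S) v \<noteq> 0" "m (S \<union> Z) v \<noteq> 0" using m_pos[OF v(1)] by (metis less_irrefl)+
  qed (use fin in auto)
  have do_key: "d T v = integ (V - T) (hybrid E K X Y v) v" if "T \<subseteq> Y \<union> Z" "v \<in> \<Omega>" for T v
    unfolding d_def by (rule hybrid_eq_do[OF ctx that(2) that(1) that(2) refl])
  have m_Z: "m Z v = integ (V - Z) (hybrid E K X Y x0) v" if "x0 \<in> \<Omega>" "v \<in> \<Omega>" for x0 v
    unfolding m_def p_def by (rule hybrid_eq_nondescendants[OF ctx that(1) _ that(2), symmetric]) auto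
  define g where "g = (\<lambda>v. m (Y \<union> (X \<union> Z \<union> S)) v / m (X \<union> Z \<union> S) v * (if S = {} then 1 else m (S \<union> Z) v / m Z v))"
  have "AE v in PiM V M. cond V M f Y (X \<union> Z \<union> S) v * (if S = {} then 1 else cond V M f S Z v) = g v"
    using m_eq[of "Y \<union> (X \<union> Z \<union> S)"] m_eq[of "X \<union> Z \<union> S"] m_eq[of "S \<union> Z"] m_eq[of Z] sub
    by (auto simp: cond_def g_def elim!: eventually_elim2)
  then have AEg: "AE v in PiM V M. integ S (\<lambda>v. cond V M f Y (X \<union> Z \<union> S) v *
      (if S = {} then 1 else cond V M f S Z v)) v = integ S g v"
    by (rule AE_integ_cong[OF sub(4)])
  \<comment> \<open>Division requires finiteness at almost every value of \<open>S\<close> with the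
    other coordinates fixed; \<open>AE_merge\<close> supplies this form.\<close>
  have "AE v in PiM V M. m (X \<union> Z \<union> S) v < \<infinity> \<and> m (S \<union> Z) v < \<infinity>"
    using m_fin[of "X \<union> Z \<union> S"] m_fin[of "S \<union> Z"] sub by auto
  from AE_merge[OF sub(4) this]
  have "AE v in PiM V M. integ S g v = d (Y \<union> Z) v / d Z v"
    using AE_space
  proof eventually_elim
    case (elim v)
    note v = elim(2)
    \<comment> \<open>The reference assignment is \<open>v\<close> itself. Replacing its coordinates
      in \<open>S\<close> does not touch \<open>X\<close>, so one hybrid density serves all
      \<open>s\<close>.\<close>
    let ?h = "hybrid E K X Y v"
    let ?mg = "\<lambda>s. merge (V - S) S (v, s)"
    let ?q = "integ (V - (Y \<union> (S \<union> Z))) ?h"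
    have hm: "?h \<in> borel_measurable (PiM V M)" by (rule measurable_hybrid[OF ctx v])
    have dep: "depends_on (m Z) Z"
    proof -
      have "depends_on (m Z) (V - (V - Z))"
        unfolding m_def by (intro depends_on_integ depends_on_V) auto
      then show ?thesis by (rule depends_on_mono) auto
    qed
    have "integ S g v = (\<integral>\<^sup>+ s. ?q (?mg s) / m Z v \<partial>PiM S M)"
      unfolding integ_def[of S g]
    proof (rule nn_integral_cong_AE)
      show "AE s in PiM S M. g (?mg s) = ?q (?mg s) / m Z v"
        using elim(1) AE_space
      proof eventually_elim
        case (elim s)
        have sp: "?mg s \<in> \<Omega>" using sub(4) v elim(2) by (rule merge_in_space)
        have X: "?mg s i = v i" if "i \<in> X \<union> Z" for i
          using that sub disj by (auto simp: merge_def)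
        have mZ: "m Z (?mg s) = m Z v" using X by (intro depends_onD[OF dep sp v]) auto
        have "m (Y \<union> (X \<union> Z \<union> S)) (?mg s) / m (X \<union> Z \<union> S) (?mg s) = ?q (?mg s) / m (S \<union> Z) (?mg s)"
          using key[OF v sp] X elim(1) by auto
        \<comment> \<open>The numerator \<open>m (S \<union> Z)\<close> of the density of
          \<open>S\<close> given \<open>Z\<close> cancels the denominator supplied by
          \<open>key\<close>.\<close>
        moreover have "a / b * (b / c) = a / c" if "b \<noteq> 0" "b \<noteq> top" for a b c :: ennreal
          using that by (metis divide_ennreal_def ennreal_divide_times mult.assoc mult_divide_eq_ennreal)
        moreover have "m (S \<union> Z) (?mg s) \<noteq> 0" "m (S \<union> Z) (?mg s) \<noteq> top"
          using m_pos[OF sp, of "S \<union> Z"] elim(1) by (auto simp: less_top)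
        ultimately show ?case using mZ by (cases "S = {}") (auto simp: g_def)
      qed
    qed
    also have "\<dots> = integ S ?q v / m Z v"
      unfolding integ_def[of S]
      using sub(4) v hm by (intro nn_integral_divide measurable_merge_section measurable_integ) auto
    also have "integ S ?q v = integ (V - (Y \<union> Z)) ?h v"
    proof -
      have "V - (Y \<union> Z) = S \<union> (V - (Y \<union> (S \<union> Z)))" using sub disj by auto
      moreover have "S \<inter> (V - (Y \<union> (S \<union> Z))) = {}" by auto
      ultimately show ?thesis using integ_Un[OF sub(4) _ _ hm v, of "V - (Y \<union> (S \<union> Z))"] by simp
    qed
    \<comment> \<open>Both interventional marginals are hybrid marginals at \<open>v\<close>, and on
      \<open>Z\<close> the hybrid marginal is also the observational one, so \<open>m Z v\<close>
      and \<open>d Z v\<close> coincide.\<close>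
    also have "\<dots> / m Z v = d (Y \<union> Z) v / d Z v"
      using do_key[OF _ v] m_Z[OF v v] by simp
    finally show ?case .
  qed
  moreover have "AE v in PiM V M. do_cond V E M f X Y Z v = d (Y \<union> Z) v / d Z v"
    using d_eq[of "Y \<union> Z"] d_eq[of Z] sub by (auto simp: do_cond_def elim!: eventually_elim2)
  ultimately show ?thesis using AEg by eventually_elim simp
qed

end

section \<open>From assignments on \<open>V\<close> to assignments on \<open>X\<close>,
  \<open>Y\<close> and \<open>Z\<close>\<close>

theorem mainTheorem11:
  fixes V :: "'v set" and E :: "('v \<times> 'v) set" and M :: "'v \<Rightarrow> 'a measure"
    and X Y Z S :: "'v set"
  assumes "is_dag V E"
    and "\<And>i. i \<in> V \<Longrightarrow> sigma_finite_measure (M i)"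
    and "X \<subseteq> V" and "Y \<subseteq> V" and "Z \<subseteq> V" and "S \<subseteq> V"
    and "X \<inter> Y = {}" and "X \<inter> Z = {}" and "X \<inter> S = {}"
    and "Y \<inter> Z = {}" and "Y \<inter> S = {}" and "Z \<inter> S = {}"
    and "Z \<inter> descendants E X = {}"
    and "cond_adjustment_criterion E X Y Z S"
  shows "cond_adjustment_set V E M X Y Z S"
  unfolding cond_adjustment_set_def
proof (intro allI impI)
  fix f assume f: "consistent_with V E M f"
  interpret sigma_finite_family V M
    by (rule sigma_finite_family.intro) (use assms(1,2) in \<open>simp_all add: is_dag_def\<close>)
  let ?U = "X \<union> Y \<union> Z"
  let ?rhs = "\<lambda>v. if S = {} then cond V M f Y (X \<union> Z) v
    else (\<integral>\<^sup>+ s. cond V M f Y (X \<union> Z \<union> S) (merge ?U S (v, s)) * cond V M f S Z (merge ?U S (v, s)) \<partial>PiM S M)"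
  have pos: "is_pos_density V M f" using f by (simp add: consistent_with_def)
  have U: "?U \<subseteq> V" using assms(3-5) by simp
  then have U': "?U \<union> (V - ?U) = V" by blast
  have "AE v in PiM V M. do_cond V E M f X Y Z v = ?rhs v"
    using cond_adjustment_AE[OF assms(1) assms(3-) f] AE_space
  proof eventually_elim
    case (elim v)
    show ?case
    proof (cases "S = {}")
      case True
      then show ?thesis using elim by (simp add: integ_empty)
    next
      case False
      \<comment> \<open>The two merges differ only off \<open>X\<close>, \<open>Y\<close>,
        \<open>Z\<close>, \<open>S\<close>, where the conditional densities do not read their
        argument.\<close>
      have "cond V M f Y (X \<union> Z \<union> S) (merge (V - S) S (v, s)) * cond V M f S Z (merge (V - S) S (v, s))
          = cond V M f Y (X \<union> Z \<union> S) (merge ?U S (v, s)) * cond V M f S Z (merge ?U S (v, s))" for s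
        using assms by (intro arg_cong2[where f = times] cond_cong) (auto simp: merge_def)
      then show ?thesis using elim False by (simp add: integ_def)
    qed
  qed
  \<comment> \<open>Both sides ignore the coordinates outside \<open>?U\<close>, so after the split
    the statement under the quantifier over \<open>w\<close> is constant and
    \<open>AE_PiM_const\<close> removes it.\<close>
  then have "AE u in PiM ?U M. AE w in PiM (V - ?U) M.
      do_cond V E M f X Y Z (merge ?U (V - ?U) (u, w)) = ?rhs (merge ?U (V - ?U) (u, w))"
    using AE_PiM_split[OF U Diff_subset Diff_disjoint] by (simp only: U')
  then show "AE v in PiM ?U M. do_cond V E M f X Y Z v = ?rhs v"
  proof (rule eventually_mono)
    fix u assume *: "AE w in PiM (V - ?U) M.
      do_cond V E M f X Y Z (merge ?U (V - ?U) (u, w)) = ?rhs (merge ?U (V - ?U) (u, w))"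
    have "do_cond V E M f X Y Z (merge ?U (V - ?U) (u, w)) = do_cond V E M f X Y Z u" for w
      unfolding do_cond_def by (intro arg_cong2[where f = divide] do_marg_cong) auto
    moreover have "?rhs (merge ?U (V - ?U) (u, w)) = ?rhs u" for w
    proof -
      have "merge ?U S (merge ?U (V - ?U) (u, w), s) = merge ?U S (u, s)" for s
        by (auto simp: merge_def)
      moreover have "cond V M f Y (X \<union> Z) (merge ?U (V - ?U) (u, w)) = cond V M f Y (X \<union> Z) u"
        by (intro cond_cong) auto
      ultimately show ?thesis by simp
    qed
    ultimately have "AE w in PiM (V - ?U) M. do_cond V E M f X Y Z u = ?rhs u"
      using * by simp
    then show "do_cond V E M f X Y Z u = ?rhs u"
      by (rule AE_PiM_const[OF Diff_subset emeasure_space_nonzero[OF pos]])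
  qed
qed

end
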